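(* Let $\mathcal H^{rg}$ be the Hopf algebra of ribbon graphs up to joins and isomorphism, and let $\alpha(\mathbf a,\mathbf b)=\exp_*(\delta_{\mathbf a})*\exp_*(\delta_{\mathbf b})$ with $\delta_{\mathbf a}=x_1\delta_b+x_2\delta_o+\sqrt{x_1x_2}\,\delta_n$ and $\delta_{\mathbf b}=y_1\delta_b+y_2\delta_o+\sqrt{y_1y_2}\,\delta_n$. Then for every ribbon graph $G$ with edge set $E$, $$\alpha(\mathbf a,\mathbf b)(G)=x_1^{\rho(G)}\,y_2^{|E|-\rho(G)}\,\widetilde R_G\Big(\frac{y_1}{x_1}+1,\frac{x_2}{y_2}+1\Big).$$
   Context: A ribbon graph $G=(V,E)$ is a surface with boundary given as a union of discs, the vertices $V$ and edges $E$, such that vertices and edges meet in disjoint line segments, each such segment lies on the boundary of exactly one vertex and one edge, and each edge contains exactly two such segments; ribbon graphs are considered up to homeomorphism preserving this structure (orientation preserving if orientable). $G\backslash A$ deletes the edges of $A$. Contraction of $e$ with incident vertices $u,v$: attach a disc along each boundary component of $e\cup u\cup v$ and delete the interior of $e\cup u\cup v$ (the new discs are vertices). $G$ is a join $P\vee Q$ of nontrivial ribbon subgraphs if $G=P\cup Q$, $P\cap Q=\{v\}$ a single vertex, and there is an arc on $v$ where all edges of $P$ at $v$ meet it and no edges of $Q$ do. $\mathcal H^{rg}$ is the free module (over a field of characteristic 0) spanned by equivalence classes of ribbon graphs under isomorphism and the relation identifying $P\vee Q$ with the disjoint union $P\sqcup Q$, graded by number of edges, with multiplication disjoint union, counit $1$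 on edgeless classes and $0$ otherwise, and coproduct $\Delta(G)=\sum_{A\subseteq E}G\backslash A^c\otimes G/A$. $\delta_b,\delta_o,\delta_n$ are the linear maps equal to $1$ respectively on the class of a single non-loop edge on two vertices, of a single orientable loop (annulus) on one vertex, and of a single non-orientable loop (Möbius band) on one vertex, and $0$ on all other classes. $f*g=m\circ(f\otimes g)\circ\Delta$, $\exp_*(\delta)=\sum_{k\ge0}\delta^{*k}/k!$ with $\delta^{*0}=\varepsilon$. For $A\subseteq E$, $f(A)$ is the number of boundary components of the spanning ribbon subgraph $(V,A)$ and $\rho(A)=\frac12(|A|+|V|-f(A))$; $\rho(G)=\rho(E)$; $\widetilde R_G(x,y)=\sum_{A\subseteq E}(x-1)^{\rho(G)-\rho(A)}(y-1)^{|A|-\rho(A)}$. *)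

theory Defs
  imports Complex_Main "HOL-Library.Poly_Mapping"
begin

section \<open>Ribbon graphs\<close>

text \<open>
  A ribbon graph is encoded by the cell structure that its vertex and edge discs induce on their
  boundaries.  A flag is an end point of one of the line segments in which a vertex and an edge
  meet, so every edge disc carries four flags.  The flags cut the boundaries of the discs into
  arcs of three kinds, and each kind pairs off the flags:

  \<^item> \<open>seg\<close> swaps the two ends of a line segment common to a vertex and an edge;
  \<^item> \<open>side\<close> swaps the two ends of an arc of an edge boundary that lies on no vertex;
  \<^item> \<open>arc\<close> swaps the two ends of an arc of a vertex boundary that lies on no edge.

  The boundary of an edge disc is a circle consisting of two line segments and two sides; this says
  that \<open>seg\<close> and \<open>side\<close> commute and never agree.  The boundary of a vertex disc that meets some edge
  is an alternating circuit of \<open>seg\<close> and \<open>arc\<close>, and every such circuit bounds a disc.  Vertices that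
  meet no edge carry no flag and are counted by \<open>isol\<close>.  These data determine the surface, together
  with its discs, up to homeomorphism, and every choice of the data arises.  Ribbon graphs, orientable
  or not, are surfaces without a chosen orientation: an orientable subgraph or minor of a
  non-orientable ribbon graph inherits no orientation, so the coproduct below only makes sense for
  unoriented surfaces.
\<close>

record rg =
  flags :: "nat set"
  seg :: "nat \<Rightarrow> nat"
  side :: "nat \<Rightarrow> nat"
  arc :: "nat \<Rightarrow> nat"
  isol :: nat

definition pairing :: "nat set \<Rightarrow> (nat \<Rightarrow> nat) \<Rightarrow> bool" where
  "pairing S f \<longleftrightarrow> (\<forall>x\<in>S. f x \<in> S \<and> f x \<noteq> x \<and> f (f x) = x) \<and> (\<forall>x. x \<notin> S \<longrightarrow> f x = x)"

definition ribbon_graph :: "rg \<Rightarrow> bool" where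
  "ribbon_graph G \<longleftrightarrow> finite (flags G) \<and>
     pairing (flags G) (seg G) \<and> pairing (flags G) (side G) \<and> pairing (flags G) (arc G) \<and>
     (\<forall>x\<in>flags G. seg G (side G x) = side G (seg G x) \<and> seg G x \<noteq> side G x)"

definition circuits :: "nat set \<Rightarrow> (nat \<Rightarrow> nat) \<Rightarrow> (nat \<Rightarrow> nat) \<Rightarrow> nat set set" where
  "circuits S f g = (\<lambda>x. {y. (\<lambda>u v. v = f u \<or> v = g u)\<^sup>*\<^sup>* x y}) ` S"

text \<open>
  An edge is identified with the set of its four flags.  A vertex, and likewise a boundary
  component, is \<open>Inl C\<close> for the set \<open>C\<close> of flags on it if there are any, and otherwise \<open>Inr i\<close> for
  the \<open>i\<close>-th isolated vertex (whose boundary is also a boundary component of the surface).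
\<close>

definition edges :: "rg \<Rightarrow> nat set set" where
  "edges G = circuits (flags G) (seg G) (side G)"

definition verts :: "rg \<Rightarrow> (nat set + nat) set" where
  "verts G = circuits (flags G) (seg G) (arc G) <+> {..<isol G}"

definition boundary_components :: "rg \<Rightarrow> (nat set + nat) set" where
  "boundary_components G = circuits (flags G) (side G) (arc G) <+> {..<isol G}"

definition vflags :: "nat set + nat \<Rightarrow> nat set" where
  "vflags v = case_sum (\<lambda>C. C) (\<lambda>_. {}) v"

definition restr :: "nat set \<Rightarrow> (nat \<Rightarrow> nat) \<Rightarrow> nat \<Rightarrow> nat" where
  "restr K f x = (if x \<in> K then f x else x)"

text \<open>
  When edges are removed, a free arc of a new vertex boundary is a path that starts and ends in a
  flag of the set \<open>K\<close> of remaining flags and, in between, alternates old arcs \<open>c\<close> with arcs \<open>s\<close>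
  belonging to the removed edges.
\<close>

definition reroute :: "nat set \<Rightarrow> (nat \<Rightarrow> nat) \<Rightarrow> (nat \<Rightarrow> nat) \<Rightarrow> nat \<Rightarrow> nat" where
  "reroute K s c = restr K (\<lambda>x. ((c \<circ> s) ^^ (LEAST n. ((c \<circ> s) ^^ n) (c x) \<in> K)) (c x))"

text \<open>
  The ribbon subgraph with edge set \<open>A\<close> and vertex set \<open>W\<close>, where \<open>A\<close> is a set of edges of \<open>G\<close> and
  \<open>W\<close> a set of vertices of \<open>G\<close> containing all vertices incident with \<open>A\<close>.  After the removal of an
  edge, the segments in which it met the vertices become parts of free arcs.
\<close>

definition subgraph :: "rg \<Rightarrow> (nat set + nat) set \<Rightarrow> nat set set \<Rightarrow> rg" where
  "subgraph G W A =
     \<lparr>flags = \<Union>A, seg = restr (\<Union>A) (seg G), side = restr (\<Union>A) (side G),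
      arc = reroute (\<Union>A) (seg G) (arc G),
      isol = card {v \<in> W. vflags v \<inter> \<Union>A = {}}\<rparr>"

definition delete :: "rg \<Rightarrow> nat set set \<Rightarrow> rg" where
  "delete G B = subgraph G (verts G) (edges G - B)"

text \<open>
  Contraction of \<open>A\<close>: the vertices of \<open>G / A\<close> are discs attached along the boundary components of
  the spanning ribbon subgraph with edge set \<open>A\<close>.  Such a boundary component runs along free arcs of
  vertices, along the sides of the edges in \<open>A\<close>, and along the segments where the vertices meet edges
  outside \<open>A\<close>; those without segments of the last kind become isolated vertices.  For a single edge
  \<open>A = {e}\<close> this replaces \<open>e\<close> and its incident vertices as in the usual definition; all other vertices
  are unaffected.
\<close>

definition contract :: "rg \<Rightarrow> nat set set \<Rightarrow> rg" where
  "contract G A =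
     (let K = flags G - \<Union>A;
          s = (\<lambda>x. if x \<in> \<Union>A then side G x else seg G x)
      in \<lparr>flags = K, seg = restr K (seg G), side = restr K (side G),
          arc = reroute K (side G) (arc G),
          isol = isol G + card {C \<in> circuits (flags G) s (arc G). C \<inter> K = {}}\<rparr>)"

definition disjoint_union :: "rg \<Rightarrow> rg \<Rightarrow> rg" where
  "disjoint_union P Q =
     (let tag = (\<lambda>f g n. if even n then 2 * f (n div 2) else 2 * g (n div 2) + 1)
      in \<lparr>flags = (\<lambda>x. 2 * x) ` flags P \<union> (\<lambda>x. 2 * x + 1) ` flags Q,
          seg = tag (seg P) (seg Q), side = tag (side P) (side Q), arc = tag (arc P) (arc Q),
          isol = isol P + isol Q\<rparr>)"

definition isomorphic :: "rg \<Rightarrow> rg \<Rightarrow> bool" where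
  "isomorphic G H \<longleftrightarrow> isol G = isol H \<and>
     (\<exists>h. bij_betw h (flags G) (flags H) \<and>
        (\<forall>x\<in>flags G. h (seg G x) = seg H (h x) \<and> h (side G x) = side H (h x) \<and>
           h (arc G x) = arc H (h x)))"

text \<open>
  Walking around the boundary of the vertex \<open>v\<close>, the segments are \<open>{y i, seg G (y i)}\<close> with
  \<open>y i = ((arc G \<circ> seg G) ^^ i) x\<close>; an arc on \<open>v\<close> that is met by exactly the edges of \<open>P\<close> amounts to
  the segments of \<open>P\<close> at \<open>v\<close> being \<open>n\<close> consecutive ones.  The parts are nontrivial in the sense that
  each contains a vertex, namely \<open>v\<close>.  A part may consist of \<open>v\<close> alone: this makes isolated vertices
  invisible in the quotient, without which the restriction of a graph with several vertices to a
  single edge would not be equivalent to that edge.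
\<close>

definition is_join :: "rg \<Rightarrow> rg \<Rightarrow> rg \<Rightarrow> bool" where
  "is_join G P Q \<longleftrightarrow>
     (\<exists>V1 V2 E1 E2 v x n.
        V1 \<union> V2 = verts G \<and> V1 \<inter> V2 = {v} \<and>
        E1 \<union> E2 = edges G \<and> E1 \<inter> E2 = {} \<and>
        (\<forall>u\<in>verts G. vflags u \<inter> \<Union>E1 \<noteq> {} \<longrightarrow> u \<in> V1) \<and>
        (\<forall>u\<in>verts G. vflags u \<inter> \<Union>E2 \<noteq> {} \<longrightarrow> u \<in> V2) \<and>
        vflags v \<inter> \<Union>E1 =
          (\<Union>i<n. {((arc G \<circ> seg G) ^^ i) x, seg G (((arc G \<circ> seg G) ^^ i) x)}) \<and>
        P = subgraph G V1 E1 \<and> Q = subgraph G V2 E2)"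

inductive rg_equiv :: "rg \<Rightarrow> rg \<Rightarrow> bool" where
  iso: "rg_equiv G H" if "ribbon_graph G" "ribbon_graph H" "isomorphic G H"
| join: "rg_equiv G (disjoint_union P Q)" if "ribbon_graph G" "is_join G P Q"
| sym: "rg_equiv H G" if "rg_equiv G H"
| trans: "rg_equiv G K" if "rg_equiv G H" "rg_equiv H K"


subsection \<open>Closure properties\<close>

lemma pairing_in: "pairing S f \<Longrightarrow> x \<in> S \<Longrightarrow> f x \<in> S"
  and pairing_neq: "pairing S f \<Longrightarrow> x \<in> S \<Longrightarrow> f x \<noteq> x"
  and pairing_invol: "pairing S f \<Longrightarrow> f (f x) = x"
  by (auto simp: pairing_def)

lemma pairing_restr:
  assumes "pairing S f" "K \<subseteq> S" "\<And>x. x \<in> K \<Longrightarrow> f x \<in> K"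
  shows "pairing K (restr K f)"
  using assms by (auto simp: pairing_def restr_def subset_iff)

lemma odd_word_no_fixpoint:
  assumes s: "pairing S s" and c: "pairing S c"
  shows "x \<in> S \<Longrightarrow> ((c \<circ> s) ^^ n) (c x) \<noteq> x"
proof (induction n arbitrary: x rule: less_induct)
  case (less n)
  consider "n = 0" | "n = 1" | m where "n = Suc (Suc m)"
    by (metis One_nat_def not0_implies_Suc)
  then show ?case
  proof cases
    case 1
    then show ?thesis using pairing_neq[OF c] less.prems by simp
  next
    case 2
    have "c x \<in> S" using less.prems pairing_in[OF c] by blast
    then have "s (c x) \<noteq> c x" using pairing_neq[OF s] by blast
    then have "c (s (c x)) \<noteq> x" using pairing_invol[OF c] by metis
    then show ?thesis using 2 by simp
  next
    case 3
    define y where "y = s (c x)"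
    have "y \<in> S" using less.prems pairing_in[OF c] pairing_in[OF s] by (simp add: y_def)
    then have ne: "((c \<circ> s) ^^ m) (c y) \<noteq> y" using less.IH[of m y] 3 by (simp del: comp_apply)
    have "((c \<circ> s) ^^ n) (c x) = (c \<circ> s) (((c \<circ> s) ^^ m) ((c \<circ> s) (c x)))"
      using 3 by (simp add: funpow_swap1)
    also have "\<dots> = c (s (((c \<circ> s) ^^ m) (c y)))" by (simp add: y_def)
    finally have "((c \<circ> s) ^^ n) (c x) = c (s (((c \<circ> s) ^^ m) (c y)))" .
    then show ?thesis
      using ne pairing_invol[OF c] pairing_invol[OF s] unfolding y_def by metis
  qed
qed

lemma reroute_hits:
  assumes fin: "finite S" and s: "pairing S s" and c: "pairing S c"
    and KS: "K \<subseteq> S" and sK: "\<And>x. x \<in> K \<Longrightarrow> s x \<in> K" and x: "x \<in> K"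
  shows "\<exists>n. ((c \<circ> s) ^^ n) (c x) \<in> K"
proof -
  let ?p = "c \<circ> s"
  have xS: "x \<in> S" using x KS by blast
  have inS: "y \<in> S \<Longrightarrow> (?p ^^ n) y \<in> S" for n y
    by (induction n) (auto simp: pairing_in[OF c] pairing_in[OF s])
  have inj: "inj ?p"
    by (intro inj_compose inj_on_inverseI[of _ c] inj_on_inverseI[of _ s])
       (simp_all add: pairing_invol[OF c] pairing_invol[OF s])
  have injn: "inj (?p ^^ n)" for n
    using inj by (induction n) (auto intro: inj_compose)
  have "\<not> inj_on (\<lambda>n. (?p ^^ n) (s x)) UNIV"
  proof
    assume "inj_on (\<lambda>n. (?p ^^ n) (s x)) UNIV"
    moreover have "range (\<lambda>n. (?p ^^ n) (s x)) \<subseteq> S"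
      using inS pairing_in[OF s xS] by blast
    ultimately show False using fin finite_imageD finite_subset infinite_UNIV_nat by blast
  qed
  then obtain a b where ab: "a < b" "(?p ^^ a) (s x) = (?p ^^ b) (s x)"
    unfolding inj_on_def by (metis linorder_neqE_nat)
  define d where "d = b - a - 1"
  have b: "b = a + Suc d" using ab by (simp add: d_def)
  have "(?p ^^ a) (s x) = (?p ^^ a) ((?p ^^ Suc d) (s x))"
    using ab(2) unfolding b funpow_add by simp
  then have "s x = (?p ^^ Suc d) (s x)" using injn[of a] by (meson injD)
  also have "\<dots> = (?p ^^ d) (c x)"
    by (simp add: funpow_swap1 pairing_invol[OF s])
  finally show ?thesis using sK[OF x] by metis
qed

lemma pairing_reroute:
  assumes fin: "finite S" and s: "pairing S s" and c: "pairing S c"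
    and KS: "K \<subseteq> S" and sK: "\<And>x. x \<in> K \<Longrightarrow> s x \<in> K"
  shows "pairing K (reroute K s c)"
proof -
  let ?p = "c \<circ> s" and ?q = "s \<circ> c"
  have pq: "?p (?q y) = y" for y by (simp add: pairing_invol[OF s] pairing_invol[OF c])
  have pqn: "(?p ^^ m) ((?q ^^ (m + j)) y) = (?q ^^ j) y" for m j y
  proof (induction m)
    case (Suc m)
    have "(?p ^^ Suc m) ((?q ^^ (Suc m + j)) y) = (?p ^^ m) (?p (?q ((?q ^^ (m + j)) y)))"
      by (simp add: funpow_swap1)
    then show ?case using Suc pq by metis
  qed simp
  have pc: "(?p ^^ m) (c y) = c ((?q ^^ m) y)" for m y
    by (induction m) auto
  have main: "reroute K s c x \<in> K \<and> reroute K s c x \<noteq> x \<and> reroute K s c (reroute K s c x) = x"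
    if x: "x \<in> K" for x
  proof -
    let ?P = "\<lambda>x n. (?p ^^ n) (c x) \<in> K"
    define n where "n = (LEAST n. ?P x n)"
    define y where "y = (?p ^^ n) (c x)"
    have rx: "reroute K s c x = y" using x by (simp add: reroute_def restr_def y_def n_def)
    have yK: "y \<in> K"
      unfolding y_def n_def using LeastI_ex[OF reroute_hits[OF fin s c KS sK x]] .
    have ne: "y \<noteq> x" unfolding y_def using odd_word_no_fixpoint[OF s c] x KS by blast
    have cy: "c y = (?q ^^ n) x" unfolding y_def pc by (simp add: pairing_invol[OF c])
    have Pn: "(?p ^^ n) (c y) = x" using pqn[of n 0 x] by (simp add: cy)
    have "n = (LEAST m. ?P y m)"
    proof (rule Least_equality[symmetric])
      show "?P y n" using Pn x by simp
    next
      fix m assume Pm: "?P y m"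
      show "n \<le> m"
      proof (rule ccontr)
        assume "\<not> n \<le> m"
        then obtain j where j: "n = m + Suc j" by (metis add_Suc_right less_imp_Suc_add not_le)
        have "(?p ^^ m) (c y) = (?q ^^ Suc j) x" unfolding cy j by (rule pqn)
        also have "\<dots> = s ((?p ^^ j) (c x))" by (simp add: pc)
        finally have "s (s ((?p ^^ j) (c x))) \<in> K" using Pm sK by metis
        then have "?P x j" by (simp add: pairing_invol[OF s])
        then have "n \<le> j" unfolding n_def by (rule Least_le)
        then show False using j by simp
      qed
    qed
    then have "reroute K s c y = x" using yK Pn by (simp add: reroute_def restr_def)
    then show ?thesis using rx yK ne by simp
  qed
  moreover have "x \<notin> K \<Longrightarrow> reroute K s c x = x" for x by (simp add: reroute_def restr_def)
  ultimately show ?thesis unfolding pairing_def by blast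
qed

lemma edge_eq:
  assumes "ribbon_graph G" "x \<in> flags G"
  shows "{y. (\<lambda>u v. v = seg G u \<or> v = side G u)\<^sup>*\<^sup>* x y}
         = {x, seg G x, side G x, seg G (side G x)}" (is "?L = ?R")
proof
  let ?r = "\<lambda>u v. v = seg G u \<or> v = side G u"
  have p: "pairing (flags G) (seg G)" "pairing (flags G) (side G)"
    and com: "\<And>x. x \<in> flags G \<Longrightarrow> seg G (side G x) = side G (seg G x)"
    using assms by (auto simp: ribbon_graph_def)
  note inv = pairing_invol[OF p(1)] pairing_invol[OF p(2)]
  have "?r\<^sup>*\<^sup>* x y \<Longrightarrow> y \<in> ?R" for y
  proof (induction rule: rtranclp_induct)
    case (step y z)
    then show ?case using com[OF assms(2)] inv by (smt (verit) insert_iff empty_iff)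
  qed simp
  then show "?L \<subseteq> ?R" by blast
  have "?r\<^sup>*\<^sup>* x (seg G x)" "?r\<^sup>*\<^sup>* x (side G x)" by auto
  moreover then have "?r\<^sup>*\<^sup>* x (seg G (side G x))"
    by (metis (mono_tags, lifting) rtranclp.rtrancl_into_rtrancl)
  ultimately show "?R \<subseteq> ?L" by auto
qed

lemma edges_eq:
  assumes "ribbon_graph G"
  shows "edges G = (\<lambda>x. {x, seg G x, side G x, seg G (side G x)}) ` flags G"
  using edge_eq[OF assms] by (auto simp: edges_def circuits_def)

lemma edges_closed:
  assumes G: "ribbon_graph G" and A: "A \<subseteq> edges G"
  shows "\<Union>A \<subseteq> flags G" "x \<in> \<Union>A \<Longrightarrow> seg G x \<in> \<Union>A" "x \<in> \<Union>A \<Longrightarrow> side G x \<in> \<Union>A"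
proof -
  have p: "pairing (flags G) (seg G)" "pairing (flags G) (side G)"
    and com: "\<And>x. x \<in> flags G \<Longrightarrow> seg G (side G x) = side G (seg G x)"
    using G by (auto simp: ribbon_graph_def)
  note inv = pairing_invol[OF p(1)] pairing_invol[OF p(2)]
  have e: "\<exists>x\<in>flags G. e = {x, seg G x, side G x, seg G (side G x)}" if "e \<in> A" for e
    using that A edges_eq[OF G] by auto
  show "\<Union>A \<subseteq> flags G"
    using e pairing_in[OF p(1)] pairing_in[OF p(2)] by fastforce
  have *: "seg G x \<in> e \<and> side G x \<in> e" if "e \<in> A" "x \<in> e" for e x
    using e[OF that(1)] that(2) com inv by (smt (verit) insert_iff empty_iff)
  show "x \<in> \<Union>A \<Longrightarrow> seg G x \<in> \<Union>A" "x \<in> \<Union>A \<Longrightarrow> side G x \<in> \<Union>A"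
    using * by blast+
qed

lemma ribbon_graph_subgraph:
  assumes G: "ribbon_graph G" and A: "A \<subseteq> edges G"
  shows "ribbon_graph (subgraph G W A)"
proof -
  note cl = edges_closed[OF G A]
  have "finite (\<Union>A)" using cl(1) G finite_subset by (auto simp: ribbon_graph_def)
  moreover have "pairing (\<Union>A) (restr (\<Union>A) (seg G))" "pairing (\<Union>A) (restr (\<Union>A) (side G))"
    using G pairing_restr[of "flags G" "seg G", OF _ cl(1) cl(2)]
      pairing_restr[of "flags G" "side G", OF _ cl(1) cl(3)]
    by (simp_all add: ribbon_graph_def)
  moreover have "pairing (\<Union>A) (reroute (\<Union>A) (seg G) (arc G))"
    using G by (intro pairing_reroute[where S = "flags G"] cl) (auto simp: ribbon_graph_def)
  moreover have "\<forall>x\<in>\<Union>A. restr (\<Union>A) (seg G) (restr (\<Union>A) (side G) x)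
      = restr (\<Union>A) (side G) (restr (\<Union>A) (seg G) x)
      \<and> restr (\<Union>A) (seg G) x \<noteq> restr (\<Union>A) (side G) x"
  proof
    fix x assume x: "x \<in> \<Union>A"
    then have "x \<in> flags G" using cl(1) by blast
    then show "restr (\<Union>A) (seg G) (restr (\<Union>A) (side G) x)
      = restr (\<Union>A) (side G) (restr (\<Union>A) (seg G) x)
      \<and> restr (\<Union>A) (seg G) x \<noteq> restr (\<Union>A) (side G) x"
      using x cl(2)[OF x] cl(3)[OF x] G unfolding restr_def ribbon_graph_def by simp
  qed
  ultimately show ?thesis unfolding ribbon_graph_def subgraph_def by simp
qed

lemma ribbon_graph_delete: "ribbon_graph G \<Longrightarrow> ribbon_graph (delete G B)"
  unfolding delete_def by (rule ribbon_graph_subgraph) auto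

lemma ribbon_graph_contract:
  assumes G: "ribbon_graph G" and A: "A \<subseteq> edges G"
  shows "ribbon_graph (contract G A)"
proof -
  note cl = edges_closed[OF G A]
  define K where "K = flags G - \<Union>A"
  have p: "pairing (flags G) (seg G)" "pairing (flags G) (side G)"
    using G by (auto simp: ribbon_graph_def)
  have KF: "K \<subseteq> flags G" by (auto simp: K_def)
  have Kseg: "seg G x \<in> K" if "x \<in> K" for x
    using that cl(2)[of "seg G x"] pairing_in[OF p(1)] pairing_invol[OF p(1)]
    by (metis K_def Diff_iff)
  have Kside: "side G x \<in> K" if "x \<in> K" for x
    using that cl(3)[of "side G x"] pairing_in[OF p(2)] pairing_invol[OF p(2)]
    by (metis K_def Diff_iff)
  have "finite K" using G KF finite_subset by (auto simp: ribbon_graph_def)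
  moreover have "pairing K (restr K (seg G))" "pairing K (restr K (side G))"
    using p KF Kseg Kside by (auto intro!: pairing_restr)
  moreover have "pairing K (reroute K (side G) (arc G))"
    using G KF Kside by (intro pairing_reroute[where S = "flags G"]) (auto simp: ribbon_graph_def)
  moreover have "\<forall>x\<in>K. restr K (seg G) (restr K (side G) x)
      = restr K (side G) (restr K (seg G) x) \<and> restr K (seg G) x \<noteq> restr K (side G) x"
    using G KF Kseg Kside by (auto simp: restr_def ribbon_graph_def subset_iff)
  ultimately show ?thesis
    unfolding ribbon_graph_def contract_def Let_def K_def[symmetric] by simp
qed

lemma pairing_tag: assumes f: "pairing S f" and g: "pairing T g"
  shows "pairing ((\<lambda>x. 2 * x) ` S \<union> (\<lambda>x. 2 * x + 1) ` T)
      (\<lambda>n. if even n then 2 * f (n div 2) else 2 * g (n div 2) + 1)" (is "pairing ?U ?h")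
proof -
  have mem: "(2 * k \<in> ?U \<longleftrightarrow> k \<in> S) \<and> (2 * k + 1 \<in> ?U \<longleftrightarrow> k \<in> T)" for k
    by (auto simp: image_iff dest: arg_cong[of _ _ even])
  have h: "?h (2 * k) = 2 * f k" "?h (2 * k + 1) = 2 * g k + 1" for k
    by simp_all
  have "(n \<in> ?U \<longrightarrow> ?h n \<in> ?U \<and> ?h n \<noteq> n \<and> ?h (?h n) = n) \<and> (n \<notin> ?U \<longrightarrow> ?h n = n)" for n
  proof (cases "even n")
    case True
    then obtain k where n: "n = 2 * k" by (rule evenE)
    show ?thesis unfolding n h using mem[of k] mem[of "f k"] f unfolding pairing_def by simp
  next
    case False
    then obtain k where n: "n = 2 * k + 1" by (rule oddE)
    show ?thesis unfolding n h using mem[of k] mem[of "g k"] g unfolding pairing_def by simp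
  qed
  then show ?thesis unfolding pairing_def by blast
qed

lemma ribbon_graph_disjoint_union:
  assumes P: "ribbon_graph P" and Q: "ribbon_graph Q"
  shows "ribbon_graph (disjoint_union P Q)"
  using P Q unfolding ribbon_graph_def disjoint_union_def Let_def
  by (simp add: pairing_tag[simplified] ball_Un)

lemma rg_equiv_ribbon_graph: "rg_equiv G H \<Longrightarrow> ribbon_graph G \<and> ribbon_graph H"
proof (induction rule: rg_equiv.induct)
  case (join G P Q)
  then show ?case
    unfolding is_join_def by (auto intro!: ribbon_graph_disjoint_union ribbon_graph_subgraph)
qed auto

lemma rg_equiv_refl: "ribbon_graph G \<Longrightarrow> rg_equiv G G"
  by (rule rg_equiv.iso) (auto simp: isomorphic_def intro: exI[of _ id])

lemma ribbon_graph_edgeless: "ribbon_graph \<lparr>flags = {}, seg = id, side = id, arc = id, isol = n\<rparr>"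
  by (simp add: ribbon_graph_def pairing_def)


section \<open>The Hopf algebra of ribbon graphs up to joins and isomorphism\<close>

quotient_type rg_class = rg / partial: rg_equiv
proof (rule part_equivpI)
  show "\<exists>G. rg_equiv G G"
    using rg_equiv_refl[OF ribbon_graph_edgeless] by blast
  show "symp rg_equiv" by (auto intro: sympI rg_equiv.sym)
  show "transp rg_equiv" by (auto intro: transpI rg_equiv.trans)
qed

text \<open>
  \<open>abs_rg_class G\<close> is the class of the ribbon graph \<open>G\<close>.  The free module on the classes is
  \<open>rg_class \<Rightarrow>\<^sub>0 'k\<close>, and its tensor square is the free module on pairs of classes.
\<close>

type_synonym 'k hopf_rg = "rg_class \<Rightarrow>\<^sub>0 'k"

definition basis :: "rg \<Rightarrow> 'k::field_char_0 hopf_rg" where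
  "basis G = Poly_Mapping.single (abs_rg_class G) 1"

text \<open>
  The linear extension of the coproduct on basis elements.  The coproduct of a class does not depend
  on the ribbon graph chosen in it, since deletion and contraction commute with joins; here
  \<open>rep_rg_class\<close> chooses one.
\<close>

definition coproduct :: "'k::field_char_0 hopf_rg \<Rightarrow> (rg_class \<times> rg_class \<Rightarrow>\<^sub>0 'k)" where
  "coproduct h =
     (\<Sum>c\<in>Poly_Mapping.keys h. let G = rep_rg_class c in
        \<Sum>A\<in>Pow (edges G).
          Poly_Mapping.single (abs_rg_class (delete G (edges G - A)), abs_rg_class (contract G A))
            (Poly_Mapping.lookup h c))"

definition counit :: "'k::field_char_0 hopf_rg \<Rightarrow> 'k" where
  "counit h =
     (\<Sum>c\<in>Poly_Mapping.keys h. Poly_Mapping.lookup h c *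
        (if \<exists>G. ribbon_graph G \<and> c = abs_rg_class G \<and> edges G = {} then 1 else 0))"

text \<open>\<open>m \<circ> (f \<otimes> g)\<close> for linear functionals \<open>f\<close> and \<open>g\<close>\<close>

definition tensor_mult ::
    "('k::field_char_0 hopf_rg \<Rightarrow> 'k) \<Rightarrow> ('k hopf_rg \<Rightarrow> 'k) \<Rightarrow> (rg_class \<times> rg_class \<Rightarrow>\<^sub>0 'k) \<Rightarrow> 'k" where
  "tensor_mult f g t =
     (\<Sum>(c, d)\<in>Poly_Mapping.keys t. Poly_Mapping.lookup t (c, d) *
        (f (Poly_Mapping.single c 1) * g (Poly_Mapping.single d 1)))"

definition convolution ::
    "('k::field_char_0 hopf_rg \<Rightarrow> 'k) \<Rightarrow> ('k hopf_rg \<Rightarrow> 'k) \<Rightarrow> 'k hopf_rg \<Rightarrow> 'k"  (infixl "\<star>" 70) where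
  "f \<star> g = tensor_mult f g \<circ> coproduct"

primrec conv_power :: "('k::field_char_0 hopf_rg \<Rightarrow> 'k) \<Rightarrow> nat \<Rightarrow> 'k hopf_rg \<Rightarrow> 'k" where
  "conv_power f 0 = counit"
| "conv_power f (Suc k) = f \<star> conv_power f k"

text \<open>
  If \<open>f\<close> vanishes on edgeless classes, only finitely many terms of the exponential series are nonzero
  on any given element; \<open>Sum_any\<close> adds up these terms.
\<close>

definition conv_exp :: "('k::field_char_0 hopf_rg \<Rightarrow> 'k) \<Rightarrow> 'k hopf_rg \<Rightarrow> 'k" where
  "conv_exp f h = Sum_any (\<lambda>k. conv_power f k h / fact k)"

text \<open>
  The ribbon graphs with one edge and no isolated vertex.  The edge has flags \<open>0, 1, 2, 3\<close> in
  cyclic order, \<open>0\<close>--\<open>1\<close> and \<open>2\<close>--\<open>3\<close> being the ends of its line segments; the free arcs are those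
  given as argument.
\<close>

definition swap2 :: "nat \<Rightarrow> nat \<Rightarrow> nat \<Rightarrow> nat \<Rightarrow> nat \<Rightarrow> nat" where
  "swap2 a b c d = id(a := b, b := a, c := d, d := c)"

definition one_edge :: "(nat \<Rightarrow> nat) \<Rightarrow> rg" where
  "one_edge c = \<lparr>flags = {0, 1, 2, 3}, seg = swap2 0 1 2 3, side = swap2 1 2 3 0, arc = c, isol = 0\<rparr>"

definition bridge_rg :: rg where "bridge_rg = one_edge (swap2 0 1 2 3)"
definition orientable_loop_rg :: rg where "orientable_loop_rg = one_edge (swap2 1 2 3 0)"
definition nonorientable_loop_rg :: rg where "nonorientable_loop_rg = one_edge (swap2 0 2 1 3)"

lemma ribbon_graph_one_edge:
  "ribbon_graph bridge_rg" "ribbon_graph orientable_loop_rg" "ribbon_graph nonorientable_loop_rg"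
  by (auto simp: ribbon_graph_def pairing_def bridge_rg_def orientable_loop_rg_def
      nonorientable_loop_rg_def one_edge_def swap2_def)

definition delta :: "rg \<Rightarrow> 'k::field_char_0 hopf_rg \<Rightarrow> 'k" where
  "delta G h = Poly_Mapping.lookup h (abs_rg_class G)"

abbreviation delta_b :: "'k::field_char_0 hopf_rg \<Rightarrow> 'k" where
  "delta_b \<equiv> delta bridge_rg"

abbreviation delta_o :: "'k::field_char_0 hopf_rg \<Rightarrow> 'k" where
  "delta_o \<equiv> delta orientable_loop_rg"

abbreviation delta_n :: "'k::field_char_0 hopf_rg \<Rightarrow> 'k" where
  "delta_n \<equiv> delta nonorientable_loop_rg"


section \<open>The ribbon graph polynomial\<close>

definition rho :: "rg \<Rightarrow> nat set set \<Rightarrow> rat" where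
  "rho G A = (of_nat (card A) + of_nat (card (verts G))
              - of_nat (card (boundary_components (subgraph G (verts G) A)))) / 2"

text \<open>
  The polynomials involve square roots of their arguments, as \<open>rho\<close> takes values in half-integers.
  They are evaluated relative to a choice \<open>rt\<close> of square roots; \<open>half_pow rt x q\<close> is \<open>x\<close> to the
  power \<open>q\<close> for \<open>2 * q\<close> an integer.  An identity between such expressions requires the choice to be
  compatible with the products and quotients that occur, as it is for \<open>sqrt\<close> on positive reals or in
  the field of rational functions in the square roots of indeterminates.
\<close>

definition half_pow :: "('k \<Rightarrow> 'k) \<Rightarrow> 'k::field_char_0 \<Rightarrow> rat \<Rightarrow> 'k" where
  "half_pow rt x q = rt x powi \<lfloor>2 * q\<rfloor>"

definition R_tilde :: "('k \<Rightarrow> 'k) \<Rightarrow> rg \<Rightarrow> 'k::field_char_0 \<Rightarrow> 'k \<Rightarrow> 'k" where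
  "R_tilde rt G x y =
     (\<Sum>A\<in>Pow (edges G).
        half_pow rt (x - 1) (rho G (edges G) - rho G A) *
        half_pow rt (y - 1) (of_nat (card A) - rho G A))"

definition delta_comb ::
    "('k \<Rightarrow> 'k) \<Rightarrow> 'k \<Rightarrow> 'k \<Rightarrow> 'k::field_char_0 hopf_rg \<Rightarrow> 'k" where
  "delta_comb rt x1 x2 h = x1 * delta_b h + x2 * delta_o h + rt (x1 * x2) * delta_n h"

definition alpha ::
    "('k \<Rightarrow> 'k) \<Rightarrow> 'k \<times> 'k \<Rightarrow> 'k \<times> 'k \<Rightarrow> 'k::field_char_0 hopf_rg \<Rightarrow> 'k" where
  "alpha rt a b = conv_exp (delta_comb rt (fst a) (snd a)) \<star> conv_exp (delta_comb rt (fst b) (snd b))"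

end

theory Submission
  imports Defs
begin

text \<open>
  Let \<open>D(A)\<close> be the number of boundary components of \<open>(V, A)\<close> minus \<open>|V|\<close>, so that
  \<open>2\<rho>(A) = |A| - D(A)\<close>.  In terms of flags, \<open>f(A)\<close> counts the circuits of two pairings, one of which
  switches from \<open>seg\<close> to \<open>side\<close> on the edges in \<open>A\<close>.  Rerouting arcs does not change the circuits that
  survive, hence \<open>D\<close> restricts to subgraphs, and \<open>D\<close> of \<open>G / A\<close> at \<open>B\<close> is \<open>D(A \<union> B) - D(A)\<close>.  For a
  join, at most two arcs on each side cross over, and by parity they all lie on one circuit, whence
  \<open>D(A\<^sub>1 \<union> A\<^sub>2) = D(A\<^sub>1) + D(A\<^sub>2)\<close>; so \<open>D\<close> is an invariant of classes.  On single edges \<open>D\<close> is \<open>-1\<close>, \<open>1\<close>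
  or \<open>0\<close>, which separates the three types, and there \<open>\<delta>\<^sub>a\<close> is \<open>x\<^sub>1\<close> to the power \<open>\<rho>(G)\<close> times \<open>x\<^sub>2\<close> to the
  power \<open>|E| - \<rho>(G)\<close>.  This expression is multiplicative along \<open>G | A\<close> and \<open>G / A\<close>, so it is also the
  value of \<open>exp\<^sub>*(\<delta>\<^sub>a)\<close> at every \<open>G\<close>, and the theorem is the expansion of a single convolution.
\<close>

section \<open>Circuits of two involutions\<close>

definition circuit :: "('a \<Rightarrow> 'a) \<Rightarrow> ('a \<Rightarrow> 'a) \<Rightarrow> 'a \<Rightarrow> 'a set" where
  "circuit f g x = {y. (\<lambda>u v. v = f u \<or> v = g u)\<^sup>*\<^sup>* x y}"

lemma circuits_eq: "circuits S f g = circuit f g ` S"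
  by (simp add: circuits_def circuit_def)

lemma circuit_refl: "x \<in> circuit f g x"
  by (simp add: circuit_def)

lemma circuit_step:
  assumes "y \<in> circuit f g x"
  shows "f y \<in> circuit f g x" "g y \<in> circuit f g x"
  using assms unfolding circuit_def
  by (auto intro: rtranclp.rtrancl_into_rtrancl)

lemma circuit_start: "f x \<in> circuit f g x" "g x \<in> circuit f g x"
  by (auto intro: circuit_step circuit_refl)

text \<open>This replaces induction on paths: every later upper bound on a circuit exhibits a set
  closed under both maps.\<close>

lemma circuit_least:
  assumes "x \<in> T" "\<And>y. y \<in> T \<Longrightarrow> f y \<in> T" "\<And>y. y \<in> T \<Longrightarrow> g y \<in> T"
  shows "circuit f g x \<subseteq> T"
proof -
  have "(\<lambda>u v. v = f u \<or> v = g u)\<^sup>*\<^sup>* x y \<Longrightarrow> y \<in> T" for y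
    by (induction rule: rtranclp_induct) (use assms in auto)
  then show ?thesis by (auto simp: circuit_def)
qed

text \<open>Reachability is symmetric because an involution undoes its own steps: the set of
  \<open>z\<close> from which \<open>x\<close> can be reached is closed under both maps.\<close>

lemma circuit_eq:
  assumes f: "\<And>x. f (f x) = x" and g: "\<And>x. g (g x) = x" and y: "y \<in> circuit f g x"
  shows "circuit f g y = circuit f g x"
proof
  show "circuit f g y \<subseteq> circuit f g x"
    using y by (intro circuit_least) (auto intro: circuit_step)
  have sub: "circuit f g z \<subseteq> circuit f g w" if "z \<in> circuit f g w" for z w
    using that by (intro circuit_least) (auto intro: circuit_step)
  have "circuit f g x \<subseteq> {z. x \<in> circuit f g z}"
  proof (intro circuit_least)
    fix z assume z: "z \<in> {z. x \<in> circuit f g z}"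
    have "z \<in> circuit f g (f z)" "z \<in> circuit f g (g z)"
      using circuit_start(1)[of f "f z" g] circuit_start(2)[of g "g z" f] f g by simp_all
    then show "f z \<in> {z. x \<in> circuit f g z}" "g z \<in> {z. x \<in> circuit f g z}"
      using z sub by blast+
  qed (simp add: circuit_refl)
  then show "circuit f g x \<subseteq> circuit f g y" using y sub by blast
qed

text \<open>The two circuits bound each other: each one, intersected with \<open>T\<close>, is
  closed under the maps of the other.\<close>

lemma circuit_cong:
  assumes "x \<in> T" "\<And>y. y \<in> T \<Longrightarrow> f y \<in> T \<and> g y \<in> T \<and> f' y = f y \<and> g' y = g y"
  shows "circuit f' g' x = circuit f g x"
proof -
  have "circuit f g x \<subseteq> T \<inter> circuit f' g' x"
  proof (intro circuit_least)
    show "x \<in> T \<inter> circuit f' g' x" using assms(1) by (simp add: circuit_refl)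
    fix y assume y: "y \<in> T \<inter> circuit f' g' x"
    then show "f y \<in> T \<inter> circuit f' g' x" "g y \<in> T \<inter> circuit f' g' x"
      using assms(2)[of y] circuit_step[of y f' g' x] by auto
  qed
  moreover have "circuit f' g' x \<subseteq> T \<inter> circuit f g x"
  proof (intro circuit_least)
    show "x \<in> T \<inter> circuit f g x" using assms(1) by (simp add: circuit_refl)
    fix y assume y: "y \<in> T \<inter> circuit f g x"
    then show "f' y \<in> T \<inter> circuit f g x" "g' y \<in> T \<inter> circuit f g x"
      using assms(2)[of y] circuit_step[of y f g x] by auto
  qed
  ultimately show ?thesis by blast
qed

lemma circuits_subset:
  assumes "\<And>y. y \<in> S \<Longrightarrow> f y \<in> S \<and> g y \<in> S" "C \<in> circuits S f g"
  shows "C \<subseteq> S"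
proof -
  obtain x where "x \<in> S" "C = circuit f g x" using assms(2) unfolding circuits_eq by blast
  then show ?thesis using circuit_least[of x S f g] assms(1) by simp
qed

lemma circuit_image:
  assumes "inj_on h S" "x \<in> S"
    "\<And>y. y \<in> S \<Longrightarrow> f y \<in> S \<and> g y \<in> S \<and> f' (h y) = h (f y) \<and> g' (h y) = h (g y)"
  shows "circuit f' g' (h x) = h ` circuit f g x"
proof
  have sub: "circuit f g x \<subseteq> S" using assms by (intro circuit_least) auto
  show "circuit f' g' (h x) \<subseteq> h ` circuit f g x"
  proof (intro circuit_least)
    fix y assume "y \<in> h ` circuit f g x"
    then obtain z where z: "z \<in> circuit f g x" "y = h z" by blast
    then show "f' y \<in> h ` circuit f g x" "g' y \<in> h ` circuit f g x"
      using assms(3)[of z] sub circuit_step[OF z(1)] by auto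
  qed (simp add: circuit_refl)
  have "circuit f g x \<subseteq> {y \<in> S. h y \<in> circuit f' g' (h x)}"
  proof (intro circuit_least)
    fix y assume "y \<in> {y \<in> S. h y \<in> circuit f' g' (h x)}"
    then have y: "y \<in> S" "h y \<in> circuit f' g' (h x)" by auto
    show "f y \<in> {y \<in> S. h y \<in> circuit f' g' (h x)}" "g y \<in> {y \<in> S. h y \<in> circuit f' g' (h x)}"
      using circuit_step[OF y(2)] assms(3)[OF y(1)] by auto
  qed (simp add: circuit_refl assms(2))
  then show "h ` circuit f g x \<subseteq> circuit f' g' (h x)" by blast
qed

lemma circuits_image:
  assumes "inj_on h S"
    "\<And>y. y \<in> S \<Longrightarrow> f y \<in> S \<and> g y \<in> S \<and> f' (h y) = h (f y) \<and> g' (h y) = h (g y)"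
  shows "circuits (h ` S) f' g' = (\<lambda>C. h ` C) ` circuits S f g"
  unfolding circuits_eq image_image
  by (rule image_cong[OF refl], rule circuit_image[where S = S]) (use assms in auto)

lemma card_circuits_image:
  assumes "inj_on h S"
    "\<And>y. y \<in> S \<Longrightarrow> f y \<in> S \<and> g y \<in> S \<and> f' (h y) = h (f y) \<and> g' (h y) = h (g y)"
  shows "card (circuits (h ` S) f' g') = card (circuits S f g)"
proof -
  have "inj_on (\<lambda>C. h ` C) (circuits S f g)"
    by (rule inj_on_subset[OF inj_on_image_Pow[OF assms(1)]])
      (use circuits_subset[of S f g] assms(2) in blast)
  moreover have "circuits (h ` S) f' g' = (\<lambda>C. h ` C) ` circuits S f g"
    by (rule circuits_image) (use assms in auto)
  ultimately show ?thesis by (simp add: card_image)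
qed

section \<open>Circuits that meet or avoid a given set\<close>

lemma circuits_disjoint:
  assumes "pairing S f" "pairing S g" "C \<in> circuits S f g" "D \<in> circuits S f g" "x \<in> C" "x \<in> D"
  shows "C = D"
  using assms(3-6) circuit_eq[of f g, OF pairing_invol[OF assms(1)] pairing_invol[OF assms(2)]]
  unfolding circuits_eq by (metis imageE)

lemma circuits_meeting:
  assumes f: "pairing S f" and g: "pairing S g" and "K \<subseteq> S"
  shows "{C \<in> circuits S f g. C \<inter> K \<noteq> {}} = circuit f g ` K"
proof
  show "{C \<in> circuits S f g. C \<inter> K \<noteq> {}} \<subseteq> circuit f g ` K"
    using circuit_eq[of f g, OF pairing_invol[OF f] pairing_invol[OF g]]
    unfolding circuits_eq by blast
  show "circuit f g ` K \<subseteq> {C \<in> circuits S f g. C \<inter> K \<noteq> {}}"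
    using assms(3) circuit_refl unfolding circuits_eq by fast
qed

text \<open>Circuits are disjoint, so one that meets \<open>K\<close> is determined by its trace on
  \<open>K\<close>. Traces are what rerouting preserves.\<close>

lemma card_circuits_meeting:
  assumes f: "pairing S f" and g: "pairing S g" and K: "K \<subseteq> S"
  shows "card {C \<in> circuits S f g. C \<inter> K \<noteq> {}} = card ((\<lambda>x. circuit f g x \<inter> K) ` K)"
proof -
  have "inj_on (\<lambda>C. C \<inter> K) (circuit f g ` K)"
  proof (rule inj_onI)
    fix C D assume CD: "C \<in> circuit f g ` K" "D \<in> circuit f g ` K" "C \<inter> K = D \<inter> K"
    from CD(1) obtain x where x: "x \<in> C" "x \<in> K" using circuit_refl by fast
    then have "x \<in> D" using CD by blast
    then show "C = D"
      using circuits_disjoint[OF f g _ _ x(1)] CD circuits_meeting[OF assms] by blast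
  qed
  then show ?thesis
    unfolding circuits_meeting[OF assms] by (simp add: card_image[symmetric] image_image)
qed

lemma card_circuits_split:
  assumes "finite S"
  shows "card (circuits S f g) =
    card {C \<in> circuits S f g. C \<inter> K \<noteq> {}} + card {C \<in> circuits S f g. C \<inter> K = {}}"
proof -
  have "finite (circuits S f g)" using assms by (simp add: circuits_eq)
  moreover have "circuits S f g =
      {C \<in> circuits S f g. C \<inter> K \<noteq> {}} \<union> {C \<in> circuits S f g. C \<inter> K = {}}" by blast
  moreover have "{C \<in> circuits S f g. C \<inter> K \<noteq> {}} \<inter> {C \<in> circuits S f g. C \<inter> K = {}} = {}"
    by blast
  ultimately show ?thesis
    using card_Un_Int[of "{C \<in> circuits S f g. C \<inter> K \<noteq> {}}" "{C \<in> circuits S f g. C \<inter> K = {}}"]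
    by simp
qed

text \<open>A circuit that avoids \<open>K\<close> only applies \<open>f\<close> where
  \<open>f'\<close> agrees with it, so it is a circuit for both.\<close>

lemma circuits_missing_cong:
  assumes S: "\<And>y. y \<in> S \<Longrightarrow> f y \<in> S \<and> g y \<in> S \<and> f' y \<in> S"
    and eq: "\<And>y. y \<in> S \<Longrightarrow> y \<notin> K \<Longrightarrow> f' y = f y"
  shows "{C \<in> circuits S f' g. C \<inter> K = {}} = {C \<in> circuits S f g. C \<inter> K = {}}"
proof -
  \<comment> \<open>Stated for an arbitrary pair \<open>h\<close>, \<open>h'\<close>, so that both
    inclusions are instances.\<close>
  have "C \<in> circuits S h' g"
    if C: "C \<in> circuits S h g" "C \<inter> K = {}" and h: "\<And>y. y \<in> S \<Longrightarrow> h y \<in> S \<and> g y \<in> S"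
      "\<And>y. y \<in> S \<Longrightarrow> y \<notin> K \<Longrightarrow> h' y = h y" for h h' C
  proof -
    obtain x where x: "x \<in> S" "C = circuit h g x" using C(1) unfolding circuits_eq by blast
    have sub: "C \<subseteq> S" using circuits_subset[OF h(1) C(1)] .
    have "circuit h' g x = circuit h g x"
    proof (rule circuit_cong)
      show "x \<in> C" by (simp add: x circuit_refl)
      fix y assume y: "y \<in> C"
      then have "y \<in> S" "y \<notin> K" using sub C(2) by auto
      then show "h y \<in> C \<and> g y \<in> C \<and> h' y = h y \<and> g y = g y"
        using h(2) y circuit_step[of y h g x] by (simp add: x)
    qed
    then show ?thesis using x unfolding circuits_eq by auto
  qed
  from this[of _ f f'] this[of _ f' f] show ?thesis using S eq by auto
qed

lemma circuits_disjoint_Un: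
  assumes "finite S" "finite T" "S \<inter> T = {}"
    "\<And>y. y \<in> S \<Longrightarrow> f y \<in> S \<and> g y \<in> S" "\<And>y. y \<in> T \<Longrightarrow> f y \<in> T \<and> g y \<in> T"
  shows "card (circuits (S \<union> T) f g) = card (circuits S f g) + card (circuits T f g)"
proof -
  have "circuits S f g \<inter> circuits T f g = {}"
  proof -
    have "False" if C: "C \<in> circuits S f g" "C \<in> circuits T f g" for C
    proof -
      obtain x where "x \<in> C" using C(1) circuit_refl unfolding circuits_eq by fast
      then show False
        using circuits_subset[OF assms(4) C(1)] circuits_subset[OF assms(5) C(2)] assms(3) by blast
    qed
    then show ?thesis by blast
  qed
  moreover have "circuits (S \<union> T) f g = circuits S f g \<union> circuits T f g"
    by (simp add: circuits_eq image_Un)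
  moreover have "finite (circuits S f g)" "finite (circuits T f g)"
    using assms by (simp_all add: circuits_eq)
  ultimately show ?thesis by (simp add: card_Un_disjoint)
qed

text \<open>Two involutions that commute at \<open>x\<close> act on the orbit of \<open>x\<close>
  like a Klein four-group.\<close>

lemma circuit_commuting:
  assumes "f (g x) = g (f x)" "\<And>y. f (f y) = y" "\<And>y. g (g y) = y"
  shows "circuit f g x = {x, f x, g x, f (g x)}"
proof
  have "f y \<in> {x, f x, g x, f (g x)} \<and> g y \<in> {x, f x, g x, f (g x)}"
    if "y \<in> {x, f x, g x, f (g x)}" for y
    using that assms(2,3) assms(1) by (smt (verit) insert_iff empty_iff)
  then show "circuit f g x \<subseteq> {x, f x, g x, f (g x)}"
    by (intro circuit_least) auto
  show "{x, f x, g x, f (g x)} \<subseteq> circuit f g x"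
    by (auto intro: circuit_refl circuit_step)
qed

subsection \<open>Rerouting\<close>

text \<open>A rerouted arc abbreviates a path that alternates \<open>c\<close> and \<open>t\<close>
  and has its inner flags outside \<open>K\<close>. There \<open>s\<close> and \<open>t\<close>
  agree, so the path is also a piece of the circuit of \<open>s\<close> and \<open>c\<close>.
  Deletion uses this with \<open>t\<close> the segments, contraction with \<open>t\<close> the
  sides; \<open>s\<close> is a mixture of both.\<close>

lemma circuit_reroute:
  assumes fin: "finite S" and s: "pairing S s" and t: "pairing S t" and c: "pairing S c"
    and KS: "K \<subseteq> S" and sK: "\<And>x. x \<in> K \<Longrightarrow> s x \<in> K" and tK: "\<And>x. x \<in> K \<Longrightarrow> t x \<in> K"
    and st: "\<And>x. x \<in> S \<Longrightarrow> x \<notin> K \<Longrightarrow> s x = t x" and x: "x \<in> K"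
  shows "circuit (restr K s) (reroute K t c) x = circuit s c x \<inter> K"
proof
  let ?p = "c \<circ> t"
  let ?R = "circuit (restr K s) (reroute K t c) x"
  \<comment> \<open>The number of \<open>c \<circ> t\<close> steps after \<open>c w\<close> until
    the path from \<open>w\<close> is back in \<open>K\<close>.\<close>
  define n where "n w = (LEAST n. (?p ^^ n) (c w) \<in> K)" for w
  have st': "s z = t z" if "z \<notin> K" for z
    using that st s t by (metis pairing_def)
  have tnK: "t z \<notin> K" if "z \<notin> K" for z
    using that tK pairing_invol[OF t] by metis
  have r: "reroute K t c w = (?p ^^ n w) (c w)" if "w \<in> K" for w
    using that by (simp add: reroute_def restr_def n_def)
  have rK: "reroute K t c w \<in> K" if "w \<in> K" for w
    using pairing_in[OF pairing_reroute[OF fin t c KS tK]] that by blast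
  have before: "(?p ^^ j) (c w) \<notin> K" if "j < n w" for j w
    using that not_less_Least unfolding n_def by blast
  have pstep: "(?p ^^ Suc j) z = c (t ((?p ^^ j) z))" for j z by simp
  show "?R \<subseteq> circuit s c x \<inter> K"
  proof (intro circuit_least)
    show "x \<in> circuit s c x \<inter> K" by (simp add: x circuit_refl)
    fix y assume "y \<in> circuit s c x \<inter> K"
    then have y: "y \<in> circuit s c x" "y \<in> K" by auto
    show "restr K s y \<in> circuit s c x \<inter> K"
      using y sK circuit_step by (auto simp: restr_def)
    have "(?p ^^ j) (c y) \<in> circuit s c x" if "j \<le> n y" for j
      using that
    proof (induction j)
      case 0
      then show ?case using y by (auto intro: circuit_step)
    next
      case (Suc j)
      have "(?p ^^ j) (c y) \<in> circuit s c x" by (rule Suc.IH) (use Suc.prems in simp)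
      moreover have "(?p ^^ j) (c y) \<notin> K" by (rule before) (use Suc.prems in simp)
      ultimately show ?case unfolding pstep using circuit_step st' by metis
    qed
    then show "reroute K t c y \<in> circuit s c x \<inter> K"
      using y rK r by auto
  qed
  \<comment> \<open>The flags of the new circuit together with the flags strictly inside its
    rerouted arcs, reached either by a \<open>c\<close> step or by the \<open>t\<close> step after
    it. This set is closed under \<open>s\<close> and \<open>c\<close>, and it meets
    \<open>K\<close> only in the new circuit.\<close>
  define M where "M = {z. z \<in> K \<and> z \<in> ?R} \<union>
    {z. \<exists>w j. w \<in> K \<and> w \<in> ?R \<and> j < n w \<and> (z = (?p ^^ j) (c w) \<or> z = t ((?p ^^ j) (c w)))}"
  have on_arc: "(?p ^^ j) (c w) \<in> M" if "w \<in> K" "w \<in> ?R" "j \<le> n w" for w j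
  proof (cases "j = n w")
    case True
    then show ?thesis
      using r[OF that(1)] rK[OF that(1)] circuit_step(2)[OF that(2)] by (auto simp: M_def)
  next
    case False
    then show ?thesis using that unfolding M_def by (metis (mono_tags, lifting) UnI2 le_neq_implies_less mem_Collect_eq)
  qed
  have "circuit s c x \<subseteq> M"
  proof (intro circuit_least)
    show "x \<in> M" by (simp add: M_def x circuit_refl)
    fix z assume "z \<in> M"
    then consider "z \<in> K" "z \<in> ?R"
      | w j where "w \<in> K" "w \<in> ?R" "j < n w" "z = (?p ^^ j) (c w)"
      | w j where "w \<in> K" "w \<in> ?R" "j < n w" "z = t ((?p ^^ j) (c w))"
      unfolding M_def by blast
    then have "s z \<in> M \<and> c z \<in> M"
    proof cases
      case 1
      have "restr K s z \<in> ?R" by (rule circuit_step(1)[OF 1(2)])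
      then have "s z \<in> M" using 1 sK by (simp add: M_def restr_def)
      then show ?thesis using on_arc[OF 1, of 0] by simp
    next
      case 2
      have "z \<notin> K" using before 2 by blast
      then have "s z = t z" by (rule st')
      then have "s z \<in> M" using 2 unfolding M_def by blast
      \<comment> \<open>Here \<open>c\<close> leads backwards along the arc: to its start
        \<open>w\<close> if \<open>j = 0\<close>, otherwise to the preceding flag reached by
        \<open>t\<close>.\<close>
      moreover have "c z \<in> M"
      proof (cases j)
        case 0
        then show ?thesis using 2 by (simp add: M_def pairing_invol[OF c])
      next
        case (Suc i)
        then have "c z = t ((?p ^^ i) (c w))" using 2 pstep pairing_invol[OF c] by metis
        moreover have "i < n w" using 2 Suc by simp
        ultimately show ?thesis using 2 unfolding M_def by blast
      qed
      ultimately show ?thesis by simp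
    next
      case 3
      have "z \<notin> K" using before[OF 3(3)] tnK 3(4) by blast
      then have "s z = (?p ^^ j) (c w)" using st' 3(4) pairing_invol[OF t] by metis
      moreover have "c z = (?p ^^ Suc j) (c w)" unfolding pstep 3(4) ..
      ultimately show ?thesis using on_arc[OF 3(1,2), of j] on_arc[OF 3(1,2), of "Suc j"] 3(3)
        by simp
    qed
    then show "s z \<in> M" "c z \<in> M" by auto
  qed
  moreover have "M \<inter> K \<subseteq> ?R"
    using before tnK unfolding M_def by blast
  ultimately show "circuit s c x \<inter> K \<subseteq> ?R" by blast
qed

lemma card_circuits_reroute:
  assumes "finite S" "pairing S s" "pairing S t" "pairing S c"
    and "K \<subseteq> S" "\<And>x. x \<in> K \<Longrightarrow> s x \<in> K" "\<And>x. x \<in> K \<Longrightarrow> t x \<in> K"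
    and "\<And>x. x \<in> S \<Longrightarrow> x \<notin> K \<Longrightarrow> s x = t x"
  shows "card (circuits K (restr K s) (reroute K t c)) = card {C \<in> circuits S s c. C \<inter> K \<noteq> {}}"
proof -
  have "circuits K (restr K s) (reroute K t c) = (\<lambda>x. circuit s c x \<inter> K) ` K"
    unfolding circuits_eq by (intro image_cong refl circuit_reroute[OF assms])
  then show ?thesis unfolding card_circuits_meeting[OF assms(2,4,5)] by simp
qed

subsection \<open>Parity\<close>

lemma even_card_involution:
  assumes "finite T" "\<And>x. x \<in> T \<Longrightarrow> f x \<in> T \<and> f x \<noteq> x \<and> f (f x) = x"
  shows "even (card T)"
  using assms
proof (induction "card T" arbitrary: T rule: less_induct)
  case less
  show ?case
  proof (cases "T = {}")
    case False
    then obtain x where x: "x \<in> T" by blast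
    let ?U = "T - {x, f x}"
    have fx: "f x \<in> T" "f x \<noteq> x" using less.prems(2) x by auto
    have "card T = card ?U + card {x, f x}"
      using x fx less.prems(1) by (metis Diff_partition bot.extremum card_Diff_subset card_mono finite.emptyI finite_insert insert_subset le_add_diff_inverse2)
    then have card: "card T = card ?U + 2" using fx(2) by simp
    have "even (card ?U)"
    proof (rule less.hyps)
      show "card ?U < card T" using card by simp
      show "finite ?U" using less.prems(1) by simp
      fix y assume y: "y \<in> ?U"
      then have "f y \<noteq> x" "f y \<noteq> f x" using less.prems(2) x by (metis DiffE insertCI)+
      then show "f y \<in> ?U \<and> f y \<noteq> y \<and> f (f y) = y" using y less.prems(2) by auto
    qed
    then show ?thesis using card by simp
  qed simp
qed

text \<open>Inside \<open>S\<close>, the circuit of \<open>x\<close> is paired off by \<open>s\<close>; if \<open>y\<close> were not on it, then \<open>c\<close>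
  would pair off all of it but \<open>x\<close>.\<close>

lemma circuit_crossing:
  assumes fin: "finite T" and s: "pairing T s" and c: "pairing T c"
    and ST: "S \<subseteq> T" and sS: "\<And>z. z \<in> S \<Longrightarrow> s z \<in> S"
    and two: "card {z \<in> S. c z \<notin> S} \<le> 2"
    and x: "x \<in> S" "c x \<notin> S" and y: "y \<in> S" "c y \<notin> S"
  shows "y \<in> circuit s c x"
proof (rule ccontr)
  assume ny: "y \<notin> circuit s c x"
  then have xy: "x \<noteq> y" using circuit_refl by fast
  have finX: "finite {z \<in> S. c z \<notin> S}" using finite_subset[OF ST fin] by simp
  have X: "z = x \<or> z = y" if z: "z \<in> S" "c z \<notin> S" for z
  proof (rule ccontr)
    assume "\<not> ?thesis"
    then have "card {x, y, z} = 3" using xy by simp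
    moreover have "card {x, y, z} \<le> card {z \<in> S. c z \<notin> S}"
      using x y z by (intro card_mono finX) auto
    ultimately show False using two by simp
  qed
  define C where "C = circuit s c x \<inter> S"
  have finC: "finite C" using finite_subset[OF ST fin] by (simp add: C_def)
  have "even (card C)"
  proof (rule even_card_involution[OF finC])
    fix z assume z: "z \<in> C"
    then have "z \<in> T" using ST by (auto simp: C_def)
    then show "s z \<in> C \<and> s z \<noteq> z \<and> s (s z) = z"
      using z sS pairing_neq[OF s] pairing_invol[OF s] by (auto simp: C_def intro: circuit_step)
  qed
  moreover have "even (card (C - {x}))"
  proof (rule even_card_involution)
    fix z assume z: "z \<in> C - {x}"
    then have "z \<in> S" "z \<noteq> x" "z \<noteq> y" "z \<in> T" using ST ny by (auto simp: C_def)
    moreover then have "c z \<in> S" using X by blast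
    moreover have "c z \<noteq> x" using x(2) \<open>z \<in> S\<close> pairing_invol[OF c] by metis
    ultimately show "c z \<in> C - {x} \<and> c z \<noteq> z \<and> c (c z) = z"
      using z pairing_neq[OF c] pairing_invol[OF c] by (auto simp: C_def intro: circuit_step)
  qed (use finC in simp)
  moreover have "x \<in> C" using x by (simp add: C_def circuit_refl)
  then have "card C = Suc (card (C - {x}))" using finC by (metis card_Suc_Diff1)
  ultimately show False by simp
qed

text \<open>A circuit leaves and re-enters \<open>S\<close> only along arcs that cross its border.
  By \<open>circuit_crossing\<close> all crossing flags of \<open>S\<close> lie on one circuit of
  \<open>s\<close>, so a different pairing outside \<open>S\<close> cannot bring new flags of
  \<open>S\<close> onto the circuit of \<open>x\<close>.\<close>

lemma circuit_Int_cong: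
  assumes fin: "finite T" and s: "pairing T s" and s': "pairing T s'" and c: "pairing T c"
    and ST: "S \<subseteq> T" and sS: "\<And>z. z \<in> S \<Longrightarrow> s z \<in> S" and eq: "\<And>z. z \<in> S \<Longrightarrow> s' z = s z"
    and two: "card {z \<in> S. c z \<notin> S} \<le> 2" and x: "x \<in> S"
  shows "circuit s' c x \<inter> S \<subseteq> circuit s c x"
proof -
  let ?X = "{z \<in> S. c z \<notin> S}"
  have X: "y \<in> circuit s c x" if "y \<in> ?X" "w \<in> ?X" "w \<in> circuit s c x" for w y
    using circuit_crossing[OF fin s c ST sS two, of w y] that
      circuit_eq[of s c, OF pairing_invol[OF s] pairing_invol[OF c] that(3)] by auto
  have s'n: "s' z \<notin> S" if "z \<notin> S" for z
    using that sS eq pairing_invol[OF s'] by metis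
  define M where "M = (S \<inter> circuit s c x) \<union> {z. z \<notin> S \<and> ?X \<inter> circuit s c x \<noteq> {}}"
  have "circuit s' c x \<subseteq> M"
  proof (intro circuit_least)
    show "x \<in> M" by (simp add: M_def x circuit_refl)
    fix z assume z: "z \<in> M"
    show "s' z \<in> M"
      using z eq sS s'n unfolding M_def by (auto intro: circuit_step)
    show "c z \<in> M"
    proof (cases "z \<in> S")
      case True
      then have "z \<in> circuit s c x" using z by (auto simp: M_def)
      then show ?thesis using True unfolding M_def by (auto intro: circuit_step)
    next
      case False
      then obtain w where w: "w \<in> ?X" "w \<in> circuit s c x" using z by (auto simp: M_def)
      show ?thesis
      proof (cases "c z \<in> S")
        case True
        then have "c z \<in> ?X" using False pairing_invol[OF c] by simp
        then show ?thesis using X[OF _ w] True by (simp add: M_def)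
      next
        case False
        then show ?thesis using w by (auto simp: M_def)
      qed
    qed
  qed
  then show ?thesis by (auto simp: M_def)
qed

lemma card_circuits_meeting_cong:
  assumes fin: "finite T" and s: "pairing T s" and s': "pairing T s'" and c: "pairing T c"
    and ST: "S \<subseteq> T" and sS: "\<And>z. z \<in> S \<Longrightarrow> s z \<in> S" and eq: "\<And>z. z \<in> S \<Longrightarrow> s' z = s z"
    and two: "card {z \<in> S. c z \<notin> S} \<le> 2"
  shows "card {C \<in> circuits T s' c. C \<inter> S \<noteq> {}} = card {C \<in> circuits T s c. C \<inter> S \<noteq> {}}"
proof -
  have sS': "s' z \<in> S" if "z \<in> S" for z using sS eq that by metis
  have "circuit s' c x \<inter> S = circuit s c x \<inter> S" if "x \<in> S" for x
    using circuit_Int_cong[OF fin s s' c ST sS eq two that]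
      circuit_Int_cong[OF fin s' s c ST sS' eq[symmetric] two that] by blast
  then show ?thesis
    unfolding card_circuits_meeting[OF s c ST] card_circuits_meeting[OF s' c ST]
    by (intro arg_cong[where f = card] image_cong) auto
qed

text \<open>Inclusion and exclusion: a circuit meeting both sides contains a crossing flag, and all
  of these lie on a single circuit. The correction term depends on \<open>c\<close> and
  \<open>S\<close> but not on \<open>s\<close>, which makes it cancel later.\<close>

lemma card_circuits_Un:
  assumes fin: "finite T" and s: "pairing T s" and c: "pairing T c"
    and T: "T = S \<union> S'" "S \<inter> S' = {}" and sS: "\<And>z. z \<in> S \<Longrightarrow> s z \<in> S"
    and two: "card {z \<in> S. c z \<notin> S} \<le> 2"
  shows "card {C \<in> circuits T s c. C \<inter> S \<noteq> {}} + card {C \<in> circuits T s c. C \<inter> S' \<noteq> {}} =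
    card (circuits T s c) + (if \<forall>z\<in>S. c z \<in> S then 0 else 1)"
proof -
  let ?C = "circuits T s c"
  have closed: "s z \<in> T \<and> c z \<in> T" if "z \<in> T" for z
    using that pairing_in[OF s] pairing_in[OF c] by blast
  have finC: "finite ?C" using fin by (simp add: circuits_eq)
  have "?C = {C \<in> ?C. C \<inter> S \<noteq> {}} \<union> {C \<in> ?C. C \<inter> S' \<noteq> {}}"
  proof -
    have "C \<inter> T \<noteq> {}" if "C \<in> ?C" for C
      using that circuit_refl unfolding circuits_eq by fast
    then show ?thesis using T by blast
  qed
  moreover have "{C \<in> ?C. C \<inter> S \<noteq> {}} \<inter> {C \<in> ?C. C \<inter> S' \<noteq> {}}
      = {C \<in> ?C. C \<inter> S \<noteq> {} \<and> C \<inter> S' \<noteq> {}}" by blast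
  moreover have "card {C \<in> ?C. C \<inter> S \<noteq> {} \<and> C \<inter> S' \<noteq> {}} = (if \<forall>z\<in>S. c z \<in> S then 0 else 1)"
  proof -
    \<comment> \<open>Since \<open>s\<close> preserves \<open>S\<close>, a circuit without a
      crossing flag that starts in \<open>S\<close> would stay in \<open>S\<close>.\<close>
    have cross: "\<exists>z\<in>C \<inter> S. c z \<notin> S" if C: "C \<in> ?C" "C \<inter> S \<noteq> {}" "C \<inter> S' \<noteq> {}" for C
    proof (rule ccontr)
      assume no: "\<not> (\<exists>z\<in>C \<inter> S. c z \<notin> S)"
      obtain x where x: "x \<in> C" "x \<in> S" using C(2) by blast
      have "C = circuit s c x"
        using C(1) x(1) circuit_eq[of s c, OF pairing_invol[OF s] pairing_invol[OF c]]
        unfolding circuits_eq by auto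
      moreover have "circuit s c x \<subseteq> C \<inter> S"
        using no sS x calculation by (intro circuit_least) (auto intro: circuit_step)
      ultimately show False using C(3) T(2) by blast
    qed
    show ?thesis
    proof (cases "\<forall>z\<in>S. c z \<in> S")
      case True
      then have none: "{C \<in> ?C. C \<inter> S \<noteq> {} \<and> C \<inter> S' \<noteq> {}} = {}" using cross by blast
      show ?thesis unfolding none using True by simp
    next
      case False
      then obtain a where a: "a \<in> S" "c a \<notin> S" by blast
      have "c a \<in> S'" using a T closed by blast
      then have "circuit s c a \<in> {C \<in> ?C. C \<inter> S \<noteq> {} \<and> C \<inter> S' \<noteq> {}}"
        using a T circuit_refl[of a s c] circuit_start(2)[of c a s]
        unfolding circuits_eq by blast
      moreover have "C = circuit s c a" if C: "C \<in> {C \<in> ?C. C \<inter> S \<noteq> {} \<and> C \<inter> S' \<noteq> {}}" for C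
      proof -
        obtain z where z: "z \<in> C" "z \<in> S" "c z \<notin> S" using cross C by blast
        have "z \<in> circuit s c a"
          using circuit_crossing[OF fin s c _ sS two a z(2,3)] T by blast
        then show ?thesis
          using circuits_disjoint[OF s c, of C "circuit s c a" z] C z(1) a T
          unfolding circuits_eq by blast
      qed
      ultimately have "{C \<in> ?C. C \<inter> S \<noteq> {} \<and> C \<inter> S' \<noteq> {}} = {circuit s c a}" by blast
      then show ?thesis using False by simp
    qed
  qed
  ultimately show ?thesis
    using card_Un_Int[of "{C \<in> ?C. C \<inter> S \<noteq> {}}" "{C \<in> ?C. C \<inter> S' \<noteq> {}}"] finC by simp
qed

text \<open>The number of circuits that meet one side only depends on the pairing on that side.\<close>

lemma card_circuits_modular:
  assumes fin: "finite T" and c: "pairing T c"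
    and s: "pairing T s" and s1: "pairing T s1" and s2: "pairing T s2" and s3: "pairing T s3"
    and T: "T = S \<union> S'" "S \<inter> S' = {}"
    and S: "\<And>z. z \<in> S \<Longrightarrow> s z \<in> S \<and> s1 z \<in> S \<and> s3 z = s1 z \<and> s2 z = s z"
    and S': "\<And>z. z \<in> S' \<Longrightarrow> s z \<in> S' \<and> s2 z \<in> S' \<and> s3 z = s2 z \<and> s1 z = s z"
    and two: "card {z \<in> S. c z \<notin> S} \<le> 2"
  shows "card (circuits T s3 c) + card (circuits T s c) = card (circuits T s1 c) + card (circuits T s2 c)"
proof -
  \<comment> \<open>Every crossing arc has one end on each side, so the bound of two holds for
    \<open>S'\<close> as well.\<close>
  have "c ` {z \<in> S. c z \<notin> S} = {z \<in> S'. c z \<notin> S'}"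
  proof
    show "c ` {z \<in> S. c z \<notin> S} \<subseteq> {z \<in> S'. c z \<notin> S'}"
      using T pairing_in[OF c] pairing_invol[OF c] by auto
    show "{z \<in> S'. c z \<notin> S'} \<subseteq> c ` {z \<in> S. c z \<notin> S}"
    proof
      fix z assume "z \<in> {z \<in> S'. c z \<notin> S'}"
      then have "c z \<in> {z \<in> S. c z \<notin> S}"
        using T pairing_in[OF c] pairing_invol[OF c] by auto
      then show "z \<in> c ` {z \<in> S. c z \<notin> S}" using pairing_invol[OF c] by (metis imageI)
    qed
  qed
  then have two': "card {z \<in> S'. c z \<notin> S'} \<le> 2"
    using two card_image_le[of "{z \<in> S. c z \<notin> S}" c] fin T by simp
  have sub: "S \<subseteq> T" "S' \<subseteq> T" using T by auto
  note m = card_circuits_meeting_cong[OF fin _ _ c sub(1) _ _ two]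
    card_circuits_meeting_cong[OF fin _ _ c sub(2) _ _ two']
  have "card {C \<in> circuits T s3 c. C \<inter> S \<noteq> {}} = card {C \<in> circuits T s1 c. C \<inter> S \<noteq> {}}"
    "card {C \<in> circuits T s2 c. C \<inter> S \<noteq> {}} = card {C \<in> circuits T s c. C \<inter> S \<noteq> {}}"
    "card {C \<in> circuits T s3 c. C \<inter> S' \<noteq> {}} = card {C \<in> circuits T s2 c. C \<inter> S' \<noteq> {}}"
    "card {C \<in> circuits T s1 c. C \<inter> S' \<noteq> {}} = card {C \<in> circuits T s c. C \<inter> S' \<noteq> {}}"
    using S S' by (auto intro!: m s s1 s2 s3)
  \<comment> \<open>The correction term is the same for all four pairings, so only the counts on the
    two sides remain, and these agree in pairs.\<close>
  moreover note card_circuits_Un[OF fin s c T _ two] card_circuits_Un[OF fin s1 c T _ two]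
    card_circuits_Un[OF fin s2 c T _ two] card_circuits_Un[OF fin s3 c T _ two]
  ultimately show ?thesis using S by fastforce
qed

section \<open>Boundary components of spanning ribbon subgraphs\<close>

text \<open>Tracing the boundary of \<open>(V, A)\<close> means following the sides of the edges in
  \<open>A\<close> and, at every other edge, the segment, which has become part of the vertex
  boundary.\<close>

definition switch :: "rg \<Rightarrow> nat set set \<Rightarrow> nat \<Rightarrow> nat" where
  "switch G A x = (if x \<in> \<Union>A then side G x else seg G x)"

text \<open>\<open>f(A)\<close> without the isolated vertices, read off from \<open>G\<close> itself; \<open>A = {}\<close> gives the vertices.\<close>

definition bdry :: "rg \<Rightarrow> nat set set \<Rightarrow> nat" where
  "bdry G A = card (circuits (flags G) (switch G A) (arc G))"

text \<open>Isolated vertices would add \<open>isol G\<close> to both terms, so they can be left out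
  of both.\<close>

definition defect :: "rg \<Rightarrow> nat set set \<Rightarrow> int" where
  "defect G A = int (bdry G A) - int (bdry G {})"

lemma ribbon_graphD:
  assumes "ribbon_graph G"
  shows "finite (flags G)" "pairing (flags G) (seg G)" "pairing (flags G) (side G)"
    "pairing (flags G) (arc G)"
  using assms by (auto simp: ribbon_graph_def)

lemma pairing_switch:
  assumes G: "ribbon_graph G" and A: "A \<subseteq> edges G"
  shows "pairing (flags G) (switch G A)"
proof -
  have seg: "seg G x \<notin> \<Union>A" if "x \<notin> \<Union>A" for x
    using that edges_closed(2)[OF assms] pairing_invol[OF ribbon_graphD(2)[OF G]] by metis
  show ?thesis
    using ribbon_graphD[OF G] edges_closed[OF assms] seg
    unfolding pairing_def switch_def by (smt (verit) subsetD)
qed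

lemma switch_empty: "switch G {} = seg G"
  by (auto simp: switch_def)

section \<open>Edges as disjoint sets of flags, and the edges of minors\<close>

lemma edge_cases:
  assumes G: "ribbon_graph G" and e: "e \<in> edges G" and x: "x \<in> e"
  shows "e = {x, seg G x, side G x, seg G (side G x)}" "x \<in> flags G"
proof -
  show x': "x \<in> flags G" using edges_closed(1)[OF G, of "{e}"] e x by auto
  have "e \<in> circuits (flags G) (seg G) (side G)" using e by (simp add: edges_def)
  moreover have "circuit (seg G) (side G) x \<in> circuits (flags G) (seg G) (side G)"
    using x' by (simp add: circuits_eq)
  ultimately have "e = circuit (seg G) (side G) x"
    using circuits_disjoint[OF ribbon_graphD(2,3)[OF G]] x circuit_refl by metis
  then show "e = {x, seg G x, side G x, seg G (side G x)}"
    using edge_eq[OF G x'] by (simp add: circuit_def)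
qed

lemma Union_edges: "ribbon_graph G \<Longrightarrow> \<Union>(edges G) = flags G"
  using edges_closed(1)[of G "edges G"] edges_eq[of G] by fastforce

lemma finite_edges: "ribbon_graph G \<Longrightarrow> finite (edges G)"
  by (simp add: edges_def circuits_def ribbon_graph_def)

lemma edges_disjoint:
  assumes "ribbon_graph G" "e \<in> edges G" "e' \<in> edges G" "x \<in> e" "x \<in> e'"
  shows "e = e'"
  using edge_cases(1)[OF assms(1,2,4)] edge_cases(1)[OF assms(1,3,5)] by simp

lemma edge_nonempty: "ribbon_graph G \<Longrightarrow> e \<in> edges G \<Longrightarrow> e \<noteq> {}"
  by (auto simp: edges_eq)

text \<open>Serves subgraphs and contractions alike: both alter only the arcs, while the edges
  depend on \<open>seg\<close> and \<open>side\<close> alone.\<close>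

lemma edges_restrict:
  assumes G: "ribbon_graph G" and H: "ribbon_graph H" and A: "A \<subseteq> edges G"
    and fl: "flags H = \<Union>A"
    and eq: "\<And>x. x \<in> \<Union>A \<Longrightarrow> seg H x = seg G x \<and> side H x = side G x"
  shows "edges H = A"
proof -
  have e: "{x, seg H x, side H x, seg H (side H x)} = e" if "x \<in> e" "e \<in> A" for x e
  proof -
    have x: "x \<in> \<Union>A" using that by blast
    have "e = {x, seg G x, side G x, seg G (side G x)}"
      by (rule edge_cases(1)[OF G _ that(1)]) (use that A in blast)
    then show ?thesis using eq[OF x] eq[OF edges_closed(3)[OF G A x]] by metis
  qed
  then have "edges H \<subseteq> A" unfolding edges_eq[OF H] fl by auto
  moreover have "A \<subseteq> edges H"
  proof
    fix e' assume e': "e' \<in> A"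
    then obtain x where "x \<in> e'" using A edge_nonempty[OF G] by blast
    then show "e' \<in> edges H" unfolding edges_eq[OF H] fl using e e' by blast
  qed
  ultimately show ?thesis by simp
qed

lemma Union_Diff_edges:
  assumes "ribbon_graph G" "A \<subseteq> edges G"
  shows "flags G - \<Union>A = \<Union>(edges G - A)"
proof -
  have "x \<notin> \<Union>A" if d: "d \<in> edges G - A" "x \<in> d" for x d
  proof
    assume "x \<in> \<Union>A"
    then obtain e where e: "e \<in> A" "x \<in> e" by blast
    then have "d = e" using edges_disjoint[OF assms(1), of d e x] d assms(2) by blast
    then show False using d e by blast
  qed
  then have "\<Union>(edges G - A) \<inter> \<Union>A = {}" by blast
  moreover have "\<Union>(edges G - A) \<union> \<Union>A = flags G"
    using assms(2) Union_edges[OF assms(1)] by (metis Diff_partition Un_commute Union_Un_distrib)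
  ultimately show ?thesis by blast
qed

lemma edges_subgraph:
  assumes "ribbon_graph G" "A \<subseteq> edges G"
  shows "edges (subgraph G W A) = A"
  by (rule edges_restrict[OF assms(1) ribbon_graph_subgraph[OF assms] assms(2)])
    (auto simp: subgraph_def restr_def)

lemma edges_contract:
  assumes "ribbon_graph G" "A \<subseteq> edges G"
  shows "edges (contract G A) = edges G - A"
  by (rule edges_restrict[OF assms(1) ribbon_graph_contract[OF assms]])
    (auto simp: contract_def Let_def restr_def Union_Diff_edges[OF assms])

section \<open>Boundary circuits of subgraphs and contractions\<close>

lemma bdry_split:
  assumes "ribbon_graph G"
  shows "bdry G A = card {C \<in> circuits (flags G) (switch G A) (arc G). C \<inter> K \<noteq> {}}
    + card {C \<in> circuits (flags G) (switch G A) (arc G). C \<inter> K = {}}"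
  unfolding bdry_def using ribbon_graphD(1)[OF assms] by (rule card_circuits_split)

text \<open>Outside \<open>\<Union>A\<close> the switch for \<open>B\<close> is
  \<open>seg G\<close>, the map along which \<open>subgraph\<close> reroutes. Hence exactly the
  circuits that keep a flag survive.\<close>

lemma bdry_subgraph:
  assumes G: "ribbon_graph G" and A: "A \<subseteq> edges G" and B: "B \<subseteq> A"
  shows "bdry (subgraph G W A) B =
    card {C \<in> circuits (flags G) (switch G B) (arc G). C \<inter> \<Union>A \<noteq> {}}"
proof -
  note cl = edges_closed[OF G A] and rg = ribbon_graphD[OF G]
  have sw: "restr (\<Union>A) (switch G B) = switch (subgraph G W A) B"
    using B by (auto simp: fun_eq_iff restr_def switch_def subgraph_def)
  have "bdry (subgraph G W A) B =
      card (circuits (\<Union>A) (restr (\<Union>A) (switch G B)) (reroute (\<Union>A) (seg G) (arc G)))"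
    by (simp add: bdry_def sw) (simp add: subgraph_def)
  also have "\<dots> = card {C \<in> circuits (flags G) (switch G B) (arc G). C \<inter> \<Union>A \<noteq> {}}"
    by (rule card_circuits_reroute[OF rg(1) pairing_switch[OF G] rg(2,4) cl(1)])
      (use A B cl in \<open>auto simp: switch_def\<close>)
  finally show ?thesis .
qed

text \<open>The two switches differ at most on \<open>K\<close>. The circuits avoiding
  \<open>K\<close> are those that disappear in a minor with flag set \<open>K\<close>; being common
  to both edge sets, they cancel in differences.\<close>

lemma missing_circuits:
  assumes G: "ribbon_graph G" and A: "A \<subseteq> edges G" and B: "B \<subseteq> edges G"
    and K: "\<And>x. x \<in> flags G \<Longrightarrow> x \<notin> K \<Longrightarrow> (x \<in> \<Union>A \<longleftrightarrow> x \<in> \<Union>B)"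
  shows "{C \<in> circuits (flags G) (switch G B) (arc G). C \<inter> K = {}} =
    {C \<in> circuits (flags G) (switch G A) (arc G). C \<inter> K = {}}"
proof (rule circuits_missing_cong)
  fix y assume y: "y \<in> flags G"
  then show "switch G A y \<in> flags G \<and> arc G y \<in> flags G \<and> switch G B y \<in> flags G"
    using pairing_in[OF pairing_switch[OF G A]] pairing_in[OF pairing_switch[OF G B]]
      pairing_in[OF ribbon_graphD(4)[OF G]] by blast
  show "switch G B y = switch G A y" if "y \<notin> K"
    using K[OF y that] by (simp only: switch_def)
qed

text \<open>Passing to the subgraph loses the circuits that miss \<open>\<Union>A\<close>, and these
  are the same for \<open>B\<close> as for \<open>{}\<close>.\<close>

lemma defect_subgraph:
  assumes G: "ribbon_graph G" and A: "A \<subseteq> edges G" and B: "B \<subseteq> A"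
  shows "defect (subgraph G W A) B = defect G B"
proof -
  have "{C \<in> circuits (flags G) (switch G B) (arc G). C \<inter> \<Union>A = {}} =
      {C \<in> circuits (flags G) (switch G {}) (arc G). C \<inter> \<Union>A = {}}"
    by (rule missing_circuits[OF G]) (use A B in auto)
  then show ?thesis
    unfolding defect_def bdry_subgraph[OF assms] bdry_subgraph[OF G A empty_subsetI]
      bdry_split[OF G, of B "\<Union>A"] bdry_split[OF G, of "{}" "\<Union>A"] by simp
qed

text \<open>On \<open>\<Union>A\<close> the switch for \<open>A \<union> B\<close> is
  \<open>side G\<close>, the map along which \<open>contract\<close> reroutes; on the other flags it
  is the switch of the contraction for \<open>B\<close>.\<close>

lemma bdry_contract:
  assumes G: "ribbon_graph G" and A: "A \<subseteq> edges G" and B: "B \<subseteq> edges G - A"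
  shows "bdry (contract G A) B =
    card {C \<in> circuits (flags G) (switch G (A \<union> B)) (arc G). C \<inter> \<Union>(edges G - A) \<noteq> {}}"
proof -
  let ?K = "\<Union>(edges G - A)"
  note cl = edges_closed[OF G, of "edges G - A", OF Diff_subset] and rg = ribbon_graphD[OF G]
  have K: "flags G - \<Union>A = ?K" by (rule Union_Diff_edges[OF G A])
  then have K': "x \<notin> \<Union>A" if "x \<in> ?K" for x using that by blast
  have sw: "restr ?K (switch G (A \<union> B)) = switch (contract G A) B"
    using B K' by (auto simp: fun_eq_iff restr_def switch_def contract_def Let_def K)
  have "bdry (contract G A) B =
      card (circuits ?K (restr ?K (switch G (A \<union> B))) (reroute ?K (side G) (arc G)))"
    by (simp add: bdry_def sw) (simp add: contract_def Let_def K)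
  also have "\<dots> = card {C \<in> circuits (flags G) (switch G (A \<union> B)) (arc G). C \<inter> ?K \<noteq> {}}"
  proof (rule card_circuits_reroute[OF rg(1) pairing_switch[OF G] rg(3,4) cl(1)])
    show "A \<union> B \<subseteq> edges G" using A B by blast
    fix x
    show "switch G (A \<union> B) x \<in> ?K" if "x \<in> ?K" using that cl by (auto simp: switch_def)
    show "switch G (A \<union> B) x = side G x" if "x \<in> flags G" "x \<notin> ?K"
      using that K by (auto simp: switch_def)
  qed (use cl in auto)
  finally show ?thesis .
qed

text \<open>The vertices of the contraction come from the boundary components of
  \<open>(V, A)\<close>, so \<open>A\<close> takes over the part of \<open>{}\<close>; the circuits
  lost are again common to both terms.\<close>

lemma defect_contract:
  assumes G: "ribbon_graph G" and A: "A \<subseteq> edges G" and B: "B \<subseteq> edges G - A"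
  shows "defect (contract G A) B = defect G (A \<union> B) - defect G A"
proof -
  let ?K = "\<Union>(edges G - A)"
  have "{C \<in> circuits (flags G) (switch G (A \<union> B)) (arc G). C \<inter> ?K = {}} =
      {C \<in> circuits (flags G) (switch G A) (arc G). C \<inter> ?K = {}}"
    by (rule missing_circuits[OF G]) (use A B in auto)
  then show ?thesis
    unfolding defect_def bdry_contract[OF assms] bdry_contract[OF G A empty_subsetI]
      bdry_split[OF G, of "A \<union> B" ?K] bdry_split[OF G, of A ?K] by simp
qed

lemma defect_empty: "defect G {} = 0"
  by (simp add: defect_def)

text \<open>Vertices of \<open>G\<close> that meet no edge of \<open>A\<close> become isolated in
  the subgraph. They are exactly the circuits that \<open>bdry G A\<close> has in addition to those
  of the subgraph, so \<open>(V, A)\<close> has \<open>bdry G A + isol G\<close> boundary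
  components.\<close>

lemma rho_eq_defect:
  assumes G: "ribbon_graph G" and A: "A \<subseteq> edges G"
  shows "rho G A = (of_nat (card A) - of_int (defect G A)) / 2"
proof -
  have card_Plus: "card (X <+> {..<n}) = card X + n" if "finite X" for X :: "nat set set" and n
    using that by (simp add: card_Plus)
  have fin: "finite (circuits (flags G) f g)" for f g
    using ribbon_graphD(1)[OF G] by (simp add: circuits_eq)
  have verts: "card (verts G) = bdry G {} + isol G"
    using fin by (simp add: verts_def card_Plus bdry_def switch_empty)
  let ?H = "subgraph G (verts G) A"
  let ?M = "{C \<in> circuits (flags G) (switch G {}) (arc G). C \<inter> \<Union>A = {}}"
  have "{v \<in> verts G. vflags v \<inter> \<Union>A = {}} = ?M <+> {..<isol G}"
    by (auto simp: verts_def vflags_def switch_empty)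
  moreover have "finite ?M" using fin by simp
  ultimately have isol: "isol ?H = card ?M + isol G"
    by (simp add: subgraph_def card_Plus)
  have H: "ribbon_graph ?H" by (rule ribbon_graph_subgraph[OF assms])
  have "side ?H = switch ?H A"
    by (auto simp: switch_def subgraph_def restr_def)
  then have "card (boundary_components ?H) = bdry ?H A + isol ?H"
    using ribbon_graphD(1)[OF H] by (simp add: boundary_components_def card_Plus bdry_def circuits_eq)
  then have "card (boundary_components ?H) = bdry G A + isol G"
    using missing_circuits[OF G _ A, of "{}" "\<Union>A"]
    by (simp add: isol bdry_subgraph[OF G A order_refl] bdry_split[OF G, of A "\<Union>A"])
  then show ?thesis by (simp add: rho_def verts defect_def)
qed

section \<open>Invariance under isomorphism and joins\<close>

text \<open>Coarser than \<open>rg_equiv\<close>, but it fixes every sum over edge sets whose terms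
  depend only on size and defect.\<close>

definition same_defect :: "rg \<Rightarrow> rg \<Rightarrow> bool" where
  "same_defect G H \<longleftrightarrow>
    (\<exists>\<beta>. bij_betw \<beta> (edges G) (edges H) \<and> (\<forall>A\<subseteq>edges G. defect H (\<beta> ` A) = defect G A))"

lemma same_defect_sym:
  assumes "same_defect G H"
  shows "same_defect H G"
proof -
  obtain \<beta> where \<beta>: "bij_betw \<beta> (edges G) (edges H)"
      "\<And>A. A \<subseteq> edges G \<Longrightarrow> defect H (\<beta> ` A) = defect G A"
    using assms by (auto simp: same_defect_def)
  let ?g = "the_inv_into (edges G) \<beta>"
  have g: "bij_betw ?g (edges H) (edges G)" by (rule bij_betw_the_inv_into[OF \<beta>(1)])
  have "defect G (?g ` A) = defect H A" if "A \<subseteq> edges H" for A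
  proof -
    have "\<beta> ` ?g ` A = A"
      using that f_the_inv_into_f_bij_betw[OF \<beta>(1)] by (force simp: image_image subset_iff)
    moreover have "?g ` A \<subseteq> edges G" using that g by (auto simp: bij_betw_def)
    ultimately show ?thesis using \<beta>(2) by metis
  qed
  then show ?thesis using g by (auto simp: same_defect_def)
qed

lemma same_defect_trans:
  assumes "same_defect G H" "same_defect H K"
  shows "same_defect G K"
proof -
  obtain \<beta> \<gamma> where \<beta>: "bij_betw \<beta> (edges G) (edges H)"
      "\<And>A. A \<subseteq> edges G \<Longrightarrow> defect H (\<beta> ` A) = defect G A"
    and \<gamma>: "bij_betw \<gamma> (edges H) (edges K)"
      "\<And>A. A \<subseteq> edges H \<Longrightarrow> defect K (\<gamma> ` A) = defect H A"
    using assms unfolding same_defect_def by blast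
  have "defect K ((\<gamma> \<circ> \<beta>) ` A) = defect G A" if "A \<subseteq> edges G" for A
  proof -
    have "\<beta> ` A \<subseteq> edges H" using that \<beta>(1) by (auto simp: bij_betw_def)
    then show ?thesis using that \<beta>(2) \<gamma>(2) by (metis image_comp)
  qed
  then show ?thesis
    using bij_betw_trans[OF \<beta>(1) \<gamma>(1)] unfolding same_defect_def by blast
qed

lemma same_defect_iso:
  assumes G: "ribbon_graph G" and H: "ribbon_graph H" and "isomorphic G H"
  shows "same_defect G H"
proof -
  obtain h where bij: "bij_betw h (flags G) (flags H)"
    and h: "\<And>x. x \<in> flags G \<Longrightarrow> h (seg G x) = seg H (h x) \<and> h (side G x) = side H (h x) \<and>
           h (arc G x) = arc H (h x)"
    using assms(3) by (auto simp: isomorphic_def)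
  note rg = ribbon_graphD[OF G]
  have inj: "inj_on h (flags G)" and im: "flags H = h ` flags G"
    using bij by (auto simp: bij_betw_def)
  have edges: "edges H = (\<lambda>e. h ` e) ` edges G"
    unfolding edges_def im
    by (rule circuits_image[OF inj]) (use h pairing_in[OF rg(2)] pairing_in[OF rg(3)] in auto)
  have "inj_on (\<lambda>e. h ` e) (edges G)"
    by (rule inj_on_subset[OF inj_on_image_Pow[OF inj]]) (use Union_edges[OF G] in auto)
  then have "bij_betw (\<lambda>e. h ` e) (edges G) (edges H)"
    by (simp add: bij_betw_def edges)
  moreover have "bdry H ((\<lambda>e. h ` e) ` A) = bdry G A" if A: "A \<subseteq> edges G" for A
    unfolding bdry_def im
  proof (rule card_circuits_image[OF inj])
    fix y assume y: "y \<in> flags G"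
    have "h y \<in> \<Union>((\<lambda>e. h ` e) ` A) \<longleftrightarrow> y \<in> \<Union>A"
    proof -
      have "\<Union>((\<lambda>e. h ` e) ` A) = h ` \<Union>A" by blast
      moreover have "\<Union>A \<subseteq> flags G" using edges_closed(1)[OF G A] .
      ultimately show ?thesis using inj y by (metis inj_on_image_mem_iff)
    qed
    then show "switch G A y \<in> flags G \<and> arc G y \<in> flags G \<and>
        switch H ((\<lambda>e. h ` e) ` A) (h y) = h (switch G A y) \<and> arc H (h y) = h (arc G y)"
      using h[OF y] pairing_in[OF pairing_switch[OF G A] y] pairing_in[OF rg(4) y]
      by (simp add: switch_def)
  qed
  ultimately show ?thesis
    unfolding same_defect_def defect_def by (metis empty_subsetI image_empty)
qed

section \<open>Disjoint unions and joins\<close>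

lemma edges_disjoint_union:
  assumes P: "ribbon_graph P" and Q: "ribbon_graph Q"
  shows "edges (disjoint_union P Q) = (\<lambda>e. (\<lambda>x. 2 * x) ` e) ` edges P \<union> (\<lambda>e. (\<lambda>x. 2 * x + 1) ` e) ` edges Q"
proof -
  let ?H = "disjoint_union P Q"
  have "circuits ((\<lambda>x. 2 * x) ` flags P) (seg ?H) (side ?H) = (\<lambda>e. (\<lambda>x. 2 * x) ` e) ` edges P"
    unfolding edges_def
    by (rule circuits_image)
      (use ribbon_graphD[OF P] in \<open>auto simp: inj_on_def disjoint_union_def Let_def pairing_in\<close>)
  moreover have "circuits ((\<lambda>x. 2 * x + 1) ` flags Q) (seg ?H) (side ?H) = (\<lambda>e. (\<lambda>x. 2 * x + 1) ` e) ` edges Q"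
    unfolding edges_def
    by (rule circuits_image)
      (use ribbon_graphD[OF Q] in \<open>auto simp: inj_on_def disjoint_union_def Let_def pairing_in\<close>)
  moreover have "flags ?H = (\<lambda>x. 2 * x) ` flags P \<union> (\<lambda>x. 2 * x + 1) ` flags Q"
    by (simp add: disjoint_union_def Let_def)
  ultimately show ?thesis by (simp add: edges_def circuits_eq image_Un)
qed

lemma bdry_disjoint_union:
  assumes P: "ribbon_graph P" and Q: "ribbon_graph Q" and A: "A \<subseteq> edges P" and B: "B \<subseteq> edges Q"
  shows "bdry (disjoint_union P Q) ((\<lambda>e. (\<lambda>x. 2 * x) ` e) ` A \<union> (\<lambda>e. (\<lambda>x. 2 * x + 1) ` e) ` B)
    = bdry P A + bdry Q B"
proof -
  let ?H = "disjoint_union P Q" and ?l = "\<lambda>x. 2 * x :: nat" and ?r = "\<lambda>x. 2 * x + 1 :: nat"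
  let ?C = "(\<lambda>e. ?l ` e) ` A \<union> (\<lambda>e. ?r ` e) ` B"
  have fl: "flags ?H = ?l ` flags P \<union> ?r ` flags Q"
    by (simp add: disjoint_union_def Let_def)
  have par: "?l x \<noteq> ?r y" for x y by presburger
  have U: "?l x \<in> \<Union>?C \<longleftrightarrow> x \<in> \<Union>A" "?r x \<in> \<Union>?C \<longleftrightarrow> x \<in> \<Union>B" for x
    using par by (auto simp: image_iff dest: arg_cong[of _ _ even])
  have swl: "switch ?H ?C (?l x) = ?l (switch P A x)" "arc ?H (?l x) = ?l (arc P x)" for x
    unfolding switch_def U by (simp_all add: disjoint_union_def Let_def)
  have swr: "switch ?H ?C (?r x) = ?r (switch Q B x)" "arc ?H (?r x) = ?r (arc Q x)" for x
    unfolding switch_def U by (simp_all add: disjoint_union_def Let_def)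
  note inP = pairing_in[OF pairing_switch[OF P A]] pairing_in[OF ribbon_graphD(4)[OF P]]
  note inQ = pairing_in[OF pairing_switch[OF Q B]] pairing_in[OF ribbon_graphD(4)[OF Q]]
  have "bdry ?H ?C = card (circuits (?l ` flags P) (switch ?H ?C) (arc ?H))
      + card (circuits (?r ` flags Q) (switch ?H ?C) (arc ?H))"
    unfolding bdry_def fl
  proof (rule circuits_disjoint_Un)
    show "?l ` flags P \<inter> ?r ` flags Q = {}" using par by blast
    show "switch ?H ?C y \<in> ?l ` flags P \<and> arc ?H y \<in> ?l ` flags P" if "y \<in> ?l ` flags P" for y
      using that inP swl by fastforce
    show "switch ?H ?C y \<in> ?r ` flags Q \<and> arc ?H y \<in> ?r ` flags Q" if "y \<in> ?r ` flags Q" for y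
      using that inQ swr by fastforce
  qed (use ribbon_graphD(1)[OF P] ribbon_graphD(1)[OF Q] in simp_all)
  also have "card (circuits (?l ` flags P) (switch ?H ?C) (arc ?H)) = bdry P A"
    unfolding bdry_def
  proof (rule card_circuits_image)
    fix y assume "y \<in> flags P"
    then show "switch P A y \<in> flags P \<and> arc P y \<in> flags P \<and> switch ?H ?C (?l y) = ?l (switch P A y) \<and>
        arc ?H (?l y) = ?l (arc P y)" using inP swl by blast
  qed (simp add: inj_on_def)
  also have "card (circuits (?r ` flags Q) (switch ?H ?C) (arc ?H)) = bdry Q B"
    unfolding bdry_def
  proof (rule card_circuits_image)
    fix y assume "y \<in> flags Q"
    then show "switch Q B y \<in> flags Q \<and> arc Q y \<in> flags Q \<and> switch ?H ?C (?r y) = ?r (switch Q B y) \<and>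
        arc ?H (?r y) = ?r (arc Q y)" using inQ swr by blast
  qed (simp add: inj_on_def)
  finally show ?thesis .
qed

text \<open>The only arcs that lead from \<open>E1\<close> to \<open>E2\<close> are those at the two ends of the interval of \<open>v\<close>.\<close>

lemma card_crossing_arcs:
  assumes G: "ribbon_graph G"
    and V: "V1 \<inter> V2 = {v}" and E: "E1 \<union> E2 = edges G"
    and V1: "\<forall>u\<in>verts G. vflags u \<inter> \<Union>E1 \<noteq> {} \<longrightarrow> u \<in> V1"
    and V2: "\<forall>u\<in>verts G. vflags u \<inter> \<Union>E2 \<noteq> {} \<longrightarrow> u \<in> V2"
    and v: "vflags v \<inter> \<Union>E1 =
          (\<Union>i<n. {((arc G \<circ> seg G) ^^ i) x, seg G (((arc G \<circ> seg G) ^^ i) x)})"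
  shows "card {z \<in> \<Union>E1. arc G z \<notin> \<Union>E1} \<le> 2"
proof -
  note rg = ribbon_graphD[OF G]
  let ?p = "arc G \<circ> seg G"
  \<comment> \<open>The outer ends of the first and the last segment of the interval. For
    \<open>n = 0\<close> there is no crossing flag at all, so the truncated \<open>n - 1\<close>
    does no harm.\<close>
  have "z \<in> {x, seg G ((?p ^^ (n - 1)) x)}" if z: "z \<in> \<Union>E1" "arc G z \<notin> \<Union>E1" for z
  proof -
    have flz: "z \<in> flags G" using z(1) E Union_edges[OF G] by blast
    have "\<Union>E1 \<union> \<Union>E2 = flags G" using E Union_edges[OF G] by (metis Union_Un_distrib)
    then have "arc G z \<in> \<Union>E2" using pairing_in[OF rg(4) flz] z(2) by (metis UnE)
    \<comment> \<open>The vertex carrying the crossing arc meets both \<open>E1\<close> and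
      \<open>E2\<close>, hence it is \<open>v\<close>.\<close>
    define u :: "nat set + nat" where "u = Inl (circuit (seg G) (arc G) z)"
    have u: "u \<in> verts G" "z \<in> vflags u" "arc G z \<in> vflags u"
      using flz by (auto simp: u_def verts_def vflags_def circuits_eq circuit_refl circuit_start)
    then have "u \<in> V1" "u \<in> V2" using V1 V2 z \<open>arc G z \<in> \<Union>E2\<close> by blast+
    then have uv: "u = v" using V by blast
    then have "z \<in> vflags v \<inter> \<Union>E1" using z u by blast
    then obtain i where i: "i < n" "z = (?p ^^ i) x \<or> z = seg G ((?p ^^ i) x)"
      unfolding v by blast
    have nz: "arc G z \<notin> {(?p ^^ j) x, seg G ((?p ^^ j) x)}" if "j < n" for j
      using z(2) that v by blast
    have pS: "(?p ^^ Suc j) x = arc G (seg G ((?p ^^ j) x))" for j by simp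
    from i(2) show ?thesis
    proof
      assume zi: "z = (?p ^^ i) x"
      show ?thesis
      proof (cases i)
        case 0
        then show ?thesis using zi by simp
      next
        case (Suc j)
        then have "arc G z = seg G ((?p ^^ j) x)"
          using zi pS pairing_invol[OF rg(4)] by metis
        then show ?thesis using nz[of j] i(1) Suc by simp
      qed
    next
      assume zi: "z = seg G ((?p ^^ i) x)"
      then have "arc G z = (?p ^^ Suc i) x" using pS by metis
      then have "\<not> Suc i < n" using nz[of "Suc i"] by blast
      then have "i = n - 1" using i(1) by simp
      then show ?thesis using zi by simp
    qed
  qed
  then have "{z \<in> \<Union>E1. arc G z \<notin> \<Union>E1} \<subseteq> {x, seg G ((?p ^^ (n - 1)) x)}" by blast
  then have "card {z \<in> \<Union>E1. arc G z \<notin> \<Union>E1} \<le> card {x, seg G ((?p ^^ (n - 1)) x)}"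
    by (rule card_mono[rotated]) simp
  also have "\<dots> \<le> 2" by (simp add: card_insert_if)
  finally show ?thesis .
qed

text \<open>At most two arcs lead out of \<open>E1\<close>, so \<open>card_circuits_modular\<close>,
  applied to the switches for \<open>{}\<close>, \<open>A\<close>, \<open>B\<close> and
  \<open>A \<union> B\<close>, makes the defect additive; \<open>defect_subgraph\<close> then moves
  the two summands to \<open>P\<close> and \<open>Q\<close>.\<close>

lemma same_defect_join:
  assumes G: "ribbon_graph G" and j: "is_join G P Q"
  shows "same_defect G (disjoint_union P Q)"
proof -
  obtain V1 V2 E1 E2 v x n where V: "V1 \<inter> V2 = {v}" and E: "E1 \<union> E2 = edges G" "E1 \<inter> E2 = {}"
    and V12: "\<forall>u\<in>verts G. vflags u \<inter> \<Union>E1 \<noteq> {} \<longrightarrow> u \<in> V1"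
      "\<forall>u\<in>verts G. vflags u \<inter> \<Union>E2 \<noteq> {} \<longrightarrow> u \<in> V2"
    and v: "vflags v \<inter> \<Union>E1 =
          (\<Union>i<n. {((arc G \<circ> seg G) ^^ i) x, seg G (((arc G \<circ> seg G) ^^ i) x)})"
    and PQ: "P = subgraph G V1 E1" "Q = subgraph G V2 E2"
    using j unfolding is_join_def by blast
  note two = card_crossing_arcs[OF G V E(1) V12 v] and rg = ribbon_graphD[OF G]
  have E': "E1 \<subseteq> edges G" "E2 \<subseteq> edges G" using E by auto
  have P: "ribbon_graph P" and Q: "ribbon_graph Q"
    using ribbon_graph_subgraph[OF G] E' PQ by auto
  have eP: "edges P = E1" and eQ: "edges Q = E2"
    using edges_subgraph[OF G] E' PQ by auto
  have disj: "\<Union>E1 \<inter> \<Union>E2 = {}" using edges_disjoint[OF G] E by blast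
  have additive: "defect G (A \<union> B) = defect P A + defect Q B" if A: "A \<subseteq> E1" and B: "B \<subseteq> E2" for A B
  proof -
    have ed: "A \<subseteq> edges G" "B \<subseteq> edges G" "A \<union> B \<subseteq> edges G" using A B E' by auto
    have "card (circuits (flags G) (switch G (A \<union> B)) (arc G)) + card (circuits (flags G) (switch G {}) (arc G))
        = card (circuits (flags G) (switch G A) (arc G)) + card (circuits (flags G) (switch G B) (arc G))"
    proof (rule card_circuits_modular[OF rg(1,4), where S = "\<Union>E1" and S' = "\<Union>E2"])
      show "flags G = \<Union>E1 \<union> \<Union>E2" using Union_edges[OF G] E by (metis Union_Un_distrib)
      fix z
      show "switch G {} z \<in> \<Union>E1 \<and> switch G A z \<in> \<Union>E1 \<and> switch G (A \<union> B) z = switch G A z \<and> switch G B z = switch G {} z"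
        if z: "z \<in> \<Union>E1"
      proof -
        have "z \<notin> \<Union>B" using z disj B by blast
        then show ?thesis using edges_closed(2,3)[OF G E'(1) z] by (simp add: switch_def)
      qed
      show "switch G {} z \<in> \<Union>E2 \<and> switch G B z \<in> \<Union>E2 \<and> switch G (A \<union> B) z = switch G B z \<and> switch G A z = switch G {} z"
        if z: "z \<in> \<Union>E2"
      proof -
        have "z \<notin> \<Union>A" using z disj A by blast
        then show ?thesis using edges_closed(2,3)[OF G E'(2) z] by (simp add: switch_def)
      qed
    qed (use pairing_switch[OF G] ed disj two in auto)
    then have "defect G (A \<union> B) = defect G A + defect G B"
      by (simp add: defect_def bdry_def)
    then show ?thesis using defect_subgraph[OF G] E' A B by (simp add: PQ)
  qed
  let ?l = "\<lambda>x. 2 * x :: nat" and ?r = "\<lambda>x. 2 * x + 1 :: nat"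
  define \<beta> where "\<beta> e = (if e \<in> E1 then ?l ` e else ?r ` e)" for e
  have im: "\<beta> ` (A \<union> B) = (\<lambda>e. ?l ` e) ` A \<union> (\<lambda>e. ?r ` e) ` B" if "A \<subseteq> E1" "B \<subseteq> E2" for A B
  proof -
    have "\<beta> ` A = (\<lambda>e. ?l ` e) ` A" "\<beta> ` B = (\<lambda>e. ?r ` e) ` B"
      using that E(2) by (intro image_cong refl; auto simp: \<beta>_def)+
    then show ?thesis by (simp add: image_Un)
  qed
  have "inj_on \<beta> (edges G)"
  proof (rule inj_onI)
    fix d e assume de: "d \<in> edges G" "e \<in> edges G" "\<beta> d = \<beta> e"
    have ne: "d \<noteq> {}" "e \<noteq> {}" using de edge_nonempty[OF G] by blast+
    have par: "?l ` a \<noteq> ?r ` b" if a: "a \<noteq> {}" for a b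
    proof
      assume eq: "?l ` a = ?r ` b"
      obtain x where "x \<in> a" using a by blast
      then have "?l x \<in> ?r ` b" using eq by blast
      then show False by (auto dest: arg_cong[of _ _ even])
    qed
    have "inj ?l" "inj ?r" by (auto simp: inj_def)
    then have "?l ` d = ?l ` e \<longleftrightarrow> d = e" "?r ` d = ?r ` e \<longleftrightarrow> d = e" by (simp_all add: inj_image_eq_iff)
    then show "d = e" using de(3) par[OF ne(1), of e] par[OF ne(2), of d] by (auto simp: \<beta>_def split: if_splits)
  qed
  moreover have "\<beta> ` edges G = edges (disjoint_union P Q)"
    using im[of E1 E2] by (simp add: edges_disjoint_union[OF P Q] eP eQ E)
  moreover have "defect (disjoint_union P Q) (\<beta> ` A) = defect G A" if A: "A \<subseteq> edges G" for A
  proof -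
    have A': "A = (A \<inter> E1) \<union> (A \<inter> E2)" using A E by blast
    have "defect (disjoint_union P Q) (\<beta> ` A) = defect P (A \<inter> E1) + defect Q (A \<inter> E2)"
      unfolding defect_def
      using bdry_disjoint_union[OF P Q, of "A \<inter> E1" "A \<inter> E2"] bdry_disjoint_union[OF P Q, of "{}" "{}"]
        im[of "A \<inter> E1" "A \<inter> E2"] A' eP eQ by simp
    then show ?thesis using additive[of "A \<inter> E1" "A \<inter> E2"] A' by simp
  qed
  ultimately show ?thesis unfolding same_defect_def bij_betw_def by blast
qed

lemma same_defect_equiv: "rg_equiv G H \<Longrightarrow> same_defect G H"
  by (induction rule: rg_equiv.induct)
    (auto intro: same_defect_iso same_defect_join same_defect_sym same_defect_trans)

lemma same_defect_card_edges: "same_defect G H \<Longrightarrow> card (edges G) = card (edges H)"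
  unfolding same_defect_def using bij_betw_same_card by blast

lemma same_defect_defect_edges:
  "same_defect G H \<Longrightarrow> defect G (edges G) = defect H (edges H)"
  by (fastforce simp: same_defect_def bij_betw_def)

section \<open>Ribbon graphs with one edge\<close>

lemma ribbon_graph_isol: "ribbon_graph (G\<lparr>isol := n\<rparr>) \<longleftrightarrow> ribbon_graph G"
  by (simp add: ribbon_graph_def)

text \<open>\<open>G\<close> is the join at \<open>v\<close> of the vertex \<open>v\<close> alone
  with \<open>G\<close> itself; splitting this join creates one isolated vertex.\<close>

lemma rg_equiv_isol_Suc:
  assumes G: "ribbon_graph G" and v: "v \<in> verts G"
  shows "rg_equiv G (G\<lparr>isol := Suc (isol G)\<rparr>)"
proof -
  let ?P = "subgraph G {v} {}" and ?Q = "subgraph G (verts G) (edges G)"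
  let ?H = "disjoint_union ?P ?Q"
  note rg = ribbon_graphD[OF G] and U = Union_edges[OF G]
  have "is_join G ?P ?Q"
    unfolding is_join_def
    \<comment> \<open>The first part has no edges, so its interval on \<open>v\<close> is empty:
      \<open>n = 0\<close> with an arbitrary starting flag.\<close>
    by (rule exI[of _ "{v}"], rule exI[of _ "verts G"], rule exI[of _ "{}"],
        rule exI[of _ "edges G"], rule exI[of _ v], rule exI[of _ undefined], rule exI[of _ 0])
      (use v in auto)
  then have GH: "rg_equiv G ?H" by (rule rg_equiv.join[OF G])
  \<comment> \<open>When all flags are kept, the first arc already ends in the kept set and
    rerouting changes nothing.\<close>
  have arcQ: "reroute (flags G) (seg G) (arc G) x = arc G x" if "x \<in> flags G" for x
  proof -
    have "arc G x \<in> flags G" using that pairing_in[OF rg(4)] by blast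
    then have "(LEAST n. ((arc G \<circ> seg G) ^^ n) (arc G x) \<in> flags G) = 0"
      by (intro Least_eq_0) simp
    then show ?thesis using that by (simp add: reroute_def restr_def)
  qed
  have "{u \<in> verts G. vflags u \<inter> flags G = {}} = Inr ` {..<isol G}"
  proof -
    have "C \<inter> flags G \<noteq> {}" if "C \<in> circuits (flags G) (seg G) (arc G)" for C
      using that circuit_refl unfolding circuits_eq by fast
    then show ?thesis by (auto simp: verts_def vflags_def)
  qed
  then have isolQ: "isol ?Q = isol G" by (simp add: subgraph_def U card_image)
  have isolP: "isol ?P = 1" by (simp add: subgraph_def)
  have "isomorphic (G\<lparr>isol := Suc (isol G)\<rparr>) ?H"
    unfolding isomorphic_def
  proof (intro conjI exI[of _ "\<lambda>x. 2 * x + 1"])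
    show "isol (G\<lparr>isol := Suc (isol G)\<rparr>) = isol ?H"
      using isolP isolQ by (simp add: disjoint_union_def Let_def)
    show "bij_betw (\<lambda>x. 2 * x + 1) (flags (G\<lparr>isol := Suc (isol G)\<rparr>)) (flags ?H)"
      by (auto simp: bij_betw_def inj_on_def disjoint_union_def Let_def subgraph_def U)
    show "\<forall>x\<in>flags (G\<lparr>isol := Suc (isol G)\<rparr>).
       2 * seg (G\<lparr>isol := Suc (isol G)\<rparr>) x + 1 = seg ?H (2 * x + 1) \<and>
       2 * side (G\<lparr>isol := Suc (isol G)\<rparr>) x + 1 = side ?H (2 * x + 1) \<and>
       2 * arc (G\<lparr>isol := Suc (isol G)\<rparr>) x + 1 = arc ?H (2 * x + 1)"
      by (simp add: disjoint_union_def Let_def subgraph_def U restr_def arcQ)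
  qed
  then have "rg_equiv (G\<lparr>isol := Suc (isol G)\<rparr>) ?H"
    using G GH rg_equiv_ribbon_graph by (intro rg_equiv.iso) (auto simp: ribbon_graph_isol)
  then show ?thesis using GH rg_equiv.sym rg_equiv.trans by blast
qed

text \<open>A flag supplies a vertex that is not isolated, at which the isolated ones are joined one
  after another.\<close>

lemma rg_equiv_isol_0:
  assumes G: "ribbon_graph G" and "flags G \<noteq> {}"
  shows "rg_equiv G (G\<lparr>isol := 0\<rparr>)"
proof -
  have "rg_equiv (G\<lparr>isol := n\<rparr>) (G\<lparr>isol := 0\<rparr>)" for n
  proof (induction n)
    case 0
    then show ?case using G by (simp add: rg_equiv_refl ribbon_graph_isol)
  next
    case (Suc n)
    obtain x where "x \<in> flags G" using assms(2) by blast
    then have "Inl (circuit (seg G) (arc G) x) \<in> verts (G\<lparr>isol := n\<rparr>)"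
      by (auto simp: verts_def circuits_eq)
    from rg_equiv_isol_Suc[OF _ this] have "rg_equiv (G\<lparr>isol := n\<rparr>) (G\<lparr>isol := Suc n\<rparr>)"
      using G by (simp add: ribbon_graph_isol)
    then show ?case using Suc rg_equiv.sym rg_equiv.trans by blast
  qed
  from this[of "isol G"] show ?thesis by simp
qed

text \<open>The flags \<open>0, 1, 2, 3\<close> run around the edge disc from \<open>p\<close>,
  starting along its segment. The condition on arcs is asked of every \<open>h\<close> with these
  four values, so a use of the lemma need not name the bijection.\<close>

lemma rg_equiv_one_edge:
  assumes G: "ribbon_graph G" and fl: "flags G = {p, seg G p, side G p, seg G (side G p)}"
    and c: "ribbon_graph (one_edge c)"
    and h: "\<And>h. h 0 = p \<Longrightarrow> h 1 = seg G p \<Longrightarrow> h 2 = side G (seg G p) \<Longrightarrow> h 3 = side G p \<Longrightarrow>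
      \<forall>i\<in>{0, 1, 2, 3}. h (c i) = arc G (h i)"
  shows "rg_equiv G (one_edge c)"
proof -
  note rg = ribbon_graphD[OF G]
  note inv = pairing_invol[OF rg(2)] pairing_invol[OF rg(3)]
  have p: "p \<in> flags G" by (simp add: fl)
  have com: "seg G (side G x) = side G (seg G x)" and ne: "seg G x \<noteq> side G x" "seg G x \<noteq> x" "side G x \<noteq> x"
    if "x \<in> flags G" for x
    using that G pairing_neq[OF rg(2)] pairing_neq[OF rg(3)] by (auto simp: ribbon_graph_def)
  have ne': "seg G (side G p) \<noteq> p" using ne(1)[OF p] inv by metis
  define h where "h = id(0 := p, 1 := seg G p, 2 := side G (seg G p), 3 := side G p)"
  have h4: "h 0 = p" "h 1 = seg G p" "h 2 = side G (seg G p)" "h 3 = side G p"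
    by (simp_all add: h_def)
  have "bij_betw h {0, 1, 2, 3} (flags G)"
    unfolding bij_betw_def
  proof
    have "distinct [p, seg G p, side G (seg G p), side G p]"
      using ne[OF p] ne' com[OF p] inv by (simp, metis)
    then show "inj_on h {0, 1, 2, 3}" using h4 by (simp add: inj_on_def)
    show "h ` {0, 1, 2, 3} = flags G" unfolding fl com[OF p] image_insert h4 by auto
  qed
  moreover have "\<forall>i\<in>{0, 1, 2, 3}. h (swap2 0 1 2 3 i) = seg G (h i)"
    "\<forall>i\<in>{0, 1, 2, 3}. h (swap2 1 2 3 0 i) = side G (h i)"
    using h4 inv com[OF p] by (simp_all add: swap2_def) metis
  ultimately have "isomorphic (one_edge c) (G\<lparr>isol := 0\<rparr>)"
    using h[of h, OF h4] unfolding isomorphic_def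
    by (intro conjI exI[of _ h]) (auto simp: one_edge_def simp del: insert_iff)
  then have "rg_equiv (one_edge c) (G\<lparr>isol := 0\<rparr>)"
    using G c by (intro rg_equiv.iso) (auto simp: ribbon_graph_isol)
  moreover have "rg_equiv G (G\<lparr>isol := 0\<rparr>)" using rg_equiv_isol_0[OF G] p by blast
  ultimately show ?thesis using rg_equiv.sym rg_equiv.trans by blast
qed

text \<open>Four flags have three perfect matchings, told apart by the partner of \<open>p\<close>;
  each of them is the arc pairing of one of the three graphs.\<close>

lemma one_edge_classification:
  assumes G: "ribbon_graph G" and 1: "card (edges G) = 1"
  shows "rg_equiv G bridge_rg \<or> rg_equiv G orientable_loop_rg \<or> rg_equiv G nonorientable_loop_rg"
proof -
  obtain e where e: "edges G = {e}" using 1 by (auto simp: card_1_singleton_iff)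
  then obtain p where p: "p \<in> e" using edge_nonempty[OF G] by fastforce
  have fl: "flags G = {p, seg G p, side G p, seg G (side G p)}"
    using edge_cases(1)[OF G _ p] e Union_edges[OF G] by simp
  note rg = ribbon_graphD[OF G]
  note inv = pairing_invol[OF rg(2)] pairing_invol[OF rg(3)] pairing_invol[OF rg(4)]
  have com: "side G (seg G p) = seg G (side G p)" using G fl by (simp add: ribbon_graph_def)
  have ne: "arc G x \<noteq> x" and cl: "arc G x \<in> flags G" if "x \<in> flags G" for x
    using that pairing_neq[OF rg(4)] pairing_in[OF rg(4)] by auto
  have mem: "p \<in> flags G" "seg G p \<in> flags G" "side G p \<in> flags G" "seg G (side G p) \<in> flags G"
    by (simp_all add: fl)
  have ds: "seg G p \<noteq> side G p" "seg G p \<noteq> p" "side G p \<noteq> p"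
    using G mem(1) pairing_neq[OF rg(2)] pairing_neq[OF rg(3)] by (auto simp: ribbon_graph_def)
  consider "arc G p = seg G p" | "arc G p = side G p" | "arc G p = seg G (side G p)"
    using ne[OF mem(1)] cl[OF mem(1)] fl by auto
  then show ?thesis
  proof cases
    case 1
    have "arc G (side G p) \<noteq> p" "arc G (side G p) \<noteq> seg G p" using 1 ds inv(3) by metis+
    then have "arc G (side G p) = seg G (side G p)"
      using ne[OF mem(3)] cl[OF mem(3)] unfolding fl by simp
    then have "rg_equiv G bridge_rg"
      unfolding bridge_rg_def
      by (intro rg_equiv_one_edge[OF G fl ribbon_graph_one_edge(1)[unfolded bridge_rg_def]])
        (use 1 com inv(3) in \<open>simp add: swap2_def, metis\<close>)
    then show ?thesis by blast
  next
    case 2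
    have "arc G (seg G p) \<noteq> p" "arc G (seg G p) \<noteq> side G p" using 2 ds inv(3) by metis+
    then have "arc G (seg G p) = seg G (side G p)"
      using ne[OF mem(2)] cl[OF mem(2)] unfolding fl by simp
    then have "rg_equiv G orientable_loop_rg"
      unfolding orientable_loop_rg_def
      by (intro rg_equiv_one_edge[OF G fl ribbon_graph_one_edge(2)[unfolded orientable_loop_rg_def]])
        (use 2 com inv(3) in \<open>simp add: swap2_def, metis\<close>)
    then show ?thesis by blast
  next
    case 3
    have "arc G (seg G p) \<noteq> p" "arc G (seg G p) \<noteq> seg G (side G p)"
      using 3 ds inv by metis+
    then have "arc G (seg G p) = side G p"
      using ne[OF mem(2)] cl[OF mem(2)] unfolding fl by simp
    then have "rg_equiv G nonorientable_loop_rg"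
      unfolding nonorientable_loop_rg_def
      by (intro rg_equiv_one_edge[OF G fl ribbon_graph_one_edge(3)[unfolded nonorientable_loop_rg_def]])
        (use 3 com inv(3) in \<open>simp add: swap2_def, metis\<close>)
    then show ?thesis by blast
  qed
qed

section \<open>Defects of the three one-edge graphs\<close>

lemma edges_one_edge:
  assumes "ribbon_graph (one_edge c)"
  shows "edges (one_edge c) = {{0, 1, 2, 3}}"
  unfolding edges_eq[OF assms] by (auto simp: one_edge_def swap2_def)

text \<open>When the arcs commute with segments and sides, vertices and boundary components are
  orbits of Klein four-groups and can be listed explicitly.\<close>

lemma defect_one_edge:
  assumes X: "ribbon_graph (one_edge c)"
    and com: "\<And>x. x \<in> {0, 1, 2, 3} \<Longrightarrow> swap2 0 1 2 3 (c x) = c (swap2 0 1 2 3 x) \<and> swap2 1 2 3 0 (c x) = c (swap2 1 2 3 0 x)"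
  shows "defect (one_edge c) (edges (one_edge c)) =
    int (card ((\<lambda>x. {x, swap2 1 2 3 0 x, c x, swap2 1 2 3 0 (c x)}) ` {0, 1, 2, 3}))
    - int (card ((\<lambda>x. {x, swap2 0 1 2 3 x, c x, swap2 0 1 2 3 (c x)}) ` {0, 1, 2, 3}))"
proof -
  let ?S = "{0, 1, 2, 3 :: nat}"
  note rg = ribbon_graphD[OF X]
  have swap: "swap2 0 1 2 3 (swap2 0 1 2 3 x) = x" "swap2 1 2 3 0 (swap2 1 2 3 0 x) = x" for x
    by (auto simp: swap2_def)
  have c: "c (c x) = x" for x using pairing_invol[OF rg(4)] by (simp add: one_edge_def)
  have "switch (one_edge c) (edges (one_edge c)) = swap2 1 2 3 0"
    unfolding edges_one_edge[OF X] by (auto simp: fun_eq_iff switch_def one_edge_def swap2_def)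
  then have "bdry (one_edge c) (edges (one_edge c)) = card (circuits ?S (swap2 1 2 3 0) c)"
    by (simp add: bdry_def) (simp add: one_edge_def)
  also have "circuits ?S (swap2 1 2 3 0) c = (\<lambda>x. {x, swap2 1 2 3 0 x, c x, swap2 1 2 3 0 (c x)}) ` ?S"
    unfolding circuits_eq by (intro image_cong refl circuit_commuting) (use com swap c in auto)
  finally have "bdry (one_edge c) (edges (one_edge c)) =
      card ((\<lambda>x. {x, swap2 1 2 3 0 x, c x, swap2 1 2 3 0 (c x)}) ` ?S)" .
  moreover have "bdry (one_edge c) {} = card (circuits ?S (swap2 0 1 2 3) c)"
    by (simp add: bdry_def switch_empty) (simp add: one_edge_def)
  moreover have "circuits ?S (swap2 0 1 2 3) c = (\<lambda>x. {x, swap2 0 1 2 3 x, c x, swap2 0 1 2 3 (c x)}) ` ?S"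
    unfolding circuits_eq by (intro image_cong refl circuit_commuting) (use com swap c in auto)
  ultimately show ?thesis by (simp add: defect_def)
qed

lemma defect_bridge: "defect bridge_rg (edges bridge_rg) = -1"
proof -
  have X: "ribbon_graph (one_edge (swap2 0 1 2 3))"
    using ribbon_graph_one_edge(1) by (simp add: bridge_rg_def)
  have "defect bridge_rg (edges bridge_rg) =
    int (card {{0, 1, 2, 3 :: nat}}) - int (card {{0, 1}, {2, 3 :: nat}})"
    unfolding bridge_rg_def
    by (subst defect_one_edge[OF X]) (auto simp: swap2_def insert_commute)
  then show ?thesis by (simp add: doubleton_eq_iff)
qed

lemma defect_orientable_loop: "defect orientable_loop_rg (edges orientable_loop_rg) = 1"
proof -
  have X: "ribbon_graph (one_edge (swap2 1 2 3 0))"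
    using ribbon_graph_one_edge(2) by (simp add: orientable_loop_rg_def)
  have "defect orientable_loop_rg (edges orientable_loop_rg) =
    int (card {{1, 2}, {0, 3 :: nat}}) - int (card {{0, 1, 2, 3 :: nat}})"
    unfolding orientable_loop_rg_def
    by (subst defect_one_edge[OF X]) (auto simp: swap2_def insert_commute)
  then show ?thesis by (simp add: doubleton_eq_iff)
qed

lemma defect_nonorientable_loop: "defect nonorientable_loop_rg (edges nonorientable_loop_rg) = 0"
proof -
  have X: "ribbon_graph (one_edge (swap2 0 2 1 3))"
    using ribbon_graph_one_edge(3) by (simp add: nonorientable_loop_rg_def)
  have "defect nonorientable_loop_rg (edges nonorientable_loop_rg) =
    int (card {{0, 1, 2, 3 :: nat}}) - int (card {{0, 1, 2, 3 :: nat}})"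
    unfolding nonorientable_loop_rg_def
    by (subst defect_one_edge[OF X]) (auto simp: swap2_def insert_commute)
  then show ?thesis by simp
qed

lemma card_edges_one_edge:
  "card (edges bridge_rg) = 1" "card (edges orientable_loop_rg) = 1"
  "card (edges nonorientable_loop_rg) = 1"
  using ribbon_graph_one_edge edges_one_edge
  by (simp_all add: bridge_rg_def orientable_loop_rg_def nonorientable_loop_rg_def)

text \<open>One direction is the invariance of size and defect; the other holds since only three
  classes are available and their defects are distinct.\<close>

lemma rg_equiv_one_edge_iff:
  assumes G: "ribbon_graph G"
  shows "rg_equiv G bridge_rg \<longleftrightarrow> card (edges G) = 1 \<and> defect G (edges G) = -1"
    and "rg_equiv G orientable_loop_rg \<longleftrightarrow> card (edges G) = 1 \<and> defect G (edges G) = 1"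
    and "rg_equiv G nonorientable_loop_rg \<longleftrightarrow> card (edges G) = 1 \<and> defect G (edges G) = 0"
proof -
  have d: "card (edges G) = 1 \<and> defect G (edges G) = -1" if "rg_equiv G bridge_rg"
    using same_defect_equiv[OF that] same_defect_card_edges same_defect_defect_edges
      card_edges_one_edge defect_bridge by metis
  moreover have "card (edges G) = 1 \<and> defect G (edges G) = 1" if "rg_equiv G orientable_loop_rg"
    using same_defect_equiv[OF that] same_defect_card_edges same_defect_defect_edges
      card_edges_one_edge defect_orientable_loop by metis
  moreover have "card (edges G) = 1 \<and> defect G (edges G) = 0" if "rg_equiv G nonorientable_loop_rg"
    using same_defect_equiv[OF that] same_defect_card_edges same_defect_defect_edges
      card_edges_one_edge defect_nonorientable_loop by metis
  ultimately show "rg_equiv G bridge_rg \<longleftrightarrow> card (edges G) = 1 \<and> defect G (edges G) = -1"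
    "rg_equiv G orientable_loop_rg \<longleftrightarrow> card (edges G) = 1 \<and> defect G (edges G) = 1"
    "rg_equiv G nonorientable_loop_rg \<longleftrightarrow> card (edges G) = 1 \<and> defect G (edges G) = 0"
    using one_edge_classification[OF G] by fastforce+
qed

text \<open>Adding an edge \<open>e\<close> to \<open>A\<close> changes the defect by that of the
  contraction by \<open>A\<close> restricted to \<open>e\<close>, a one-edge graph.\<close>

lemma abs_defect_le:
  assumes G: "ribbon_graph G" and A: "A \<subseteq> edges G"
  shows "\<bar>defect G A\<bar> \<le> int (card A)"
proof -
  have "finite A" using finite_edges[OF G] A finite_subset by blast
  then show ?thesis using A
  proof (induction A rule: finite_induct)
    case (insert e A)
    let ?C = "contract G A"
    \<comment> \<open>The vertex set enters only \<open>isol\<close>, which \<open>defect\<close>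
      does not see, so \<open>{}\<close> will do.\<close>
    let ?H = "subgraph ?C {} {e}"
    have A: "A \<subseteq> edges G" and e: "{e} \<subseteq> edges G - A" using insert by auto
    have C: "ribbon_graph ?C" and eC: "{e} \<subseteq> edges ?C"
      using ribbon_graph_contract[OF G A] edges_contract[OF G A] e by auto
    have "defect G (insert e A) - defect G A = defect ?H {e}"
      using defect_contract[OF G A e] defect_subgraph[OF C eC order_refl] by simp
    moreover have "ribbon_graph ?H" "edges ?H = {e}"
      using ribbon_graph_subgraph[OF C eC] edges_subgraph[OF C eC] by auto
    then have "\<bar>defect ?H {e}\<bar> \<le> 1"
      using one_edge_classification[of ?H] rg_equiv_one_edge_iff[of ?H] by force
    ultimately show ?case using insert by simp
  qed (simp add: defect_empty)
qed

section \<open>Characters of the Hopf algebra\<close>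

lemma rg_class_eq_iff:
  assumes "ribbon_graph G" "ribbon_graph H"
  shows "abs_rg_class G = abs_rg_class H \<longleftrightarrow> rg_equiv G H"
  using Quotient_rel[OF Quotient_rg_class, of G H] rg_equiv_refl assms by blast

lemma ribbon_graph_rep: "ribbon_graph (rep_rg_class c)"
  using Quotient_rep_reflp[OF Quotient_rg_class] rg_equiv_ribbon_graph by blast

lemma rep_abs_rg_class: "ribbon_graph G \<Longrightarrow> rg_equiv G (rep_rg_class (abs_rg_class G))"
  using Quotient_rep_abs[OF Quotient_rg_class] rg_equiv_refl rg_equiv.sym by blast

text \<open>Different indices may yield the same pair of classes, whose coefficient then
  accumulates; exchanging the sums over pairs and indices takes it apart again.\<close>

lemma tensor_mult_sum:
  fixes f g :: "'a::field_char_0 hopf_rg \<Rightarrow> 'a"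
  assumes "finite I"
  shows "tensor_mult f g (\<Sum>i\<in>I. Poly_Mapping.single (c i, d i) 1) =
    (\<Sum>i\<in>I. f (Poly_Mapping.single (c i) 1) * g (Poly_Mapping.single (d i) 1))"
proof -
  let ?t = "(\<Sum>i\<in>I. Poly_Mapping.single (c i, d i) 1) :: rg_class \<times> rg_class \<Rightarrow>\<^sub>0 'a"
  let ?k = "\<lambda>p. f (Poly_Mapping.single (fst p) 1) * g (Poly_Mapping.single (snd p) 1)"
  let ?J = "(\<lambda>i. (c i, d i)) ` I"
  have lookup: "Poly_Mapping.lookup ?t p = (\<Sum>i\<in>I. if (c i, d i) = p then 1 else 0)" for p
    by (simp add: lookup_sum lookup_single when_def)
  have sub: "Poly_Mapping.keys ?t \<subseteq> ?J"
  proof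
    fix p assume "p \<in> Poly_Mapping.keys ?t"
    then have "(\<Sum>i\<in>I. if (c i, d i) = p then 1 else (0::'a)) \<noteq> 0"
      unfolding lookup[symmetric] by (simp add: in_keys_iff)
    then obtain i where "i \<in> I" "(if (c i, d i) = p then 1 else (0::'a)) \<noteq> 0"
      by (rule sum.not_neutral_contains_not_neutral)
    then show "p \<in> ?J" by (auto split: if_splits)
  qed
  have "tensor_mult f g ?t = (\<Sum>p\<in>Poly_Mapping.keys ?t. Poly_Mapping.lookup ?t p * ?k p)"
    by (simp add: tensor_mult_def case_prod_unfold)
  also have "\<dots> = (\<Sum>p\<in>?J. Poly_Mapping.lookup ?t p * ?k p)"
    by (rule sum.mono_neutral_left) (use assms sub in \<open>auto simp: in_keys_iff\<close>)
  also have "\<dots> = (\<Sum>p\<in>?J. \<Sum>i\<in>I. if (c i, d i) = p then ?k p else 0)"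
    unfolding lookup sum_distrib_right by (intro sum.cong refl) auto
  also have "\<dots> = (\<Sum>i\<in>I. \<Sum>p\<in>?J. if (c i, d i) = p then ?k p else 0)"
    by (rule sum.swap)
  also have "\<dots> = (\<Sum>i\<in>I. ?k (c i, d i))"
    using assms by (intro sum.cong refl) (simp add: sum.delta)
  finally show ?thesis by simp
qed

text \<open>The coproduct expands over the representative \<open>H\<close> chosen in the class of
  \<open>G\<close>, which is only known to be equivalent to \<open>G\<close>.\<close>

lemma convolution_basis:
  assumes H: "H = rep_rg_class (abs_rg_class G)"
  shows "(f \<star> g) (basis G) =
    (\<Sum>A\<in>Pow (edges H). f (basis (subgraph H (verts H) A)) * g (basis (contract H A)))"
proof -
  have fin: "finite (Pow (edges H))" using finite_edges ribbon_graph_rep H by simp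
  have "coproduct (basis G :: 'a hopf_rg) = (\<Sum>A\<in>Pow (edges H).
      Poly_Mapping.single (abs_rg_class (delete H (edges H - A)), abs_rg_class (contract H A)) 1)"
    by (simp add: coproduct_def basis_def H Let_def)
  then have "(f \<star> g) (basis G) =
    (\<Sum>A\<in>Pow (edges H). f (basis (delete H (edges H - A))) * g (basis (contract H A)))"
    using tensor_mult_sum[OF fin, of f g "\<lambda>A. abs_rg_class (delete H (edges H - A))"
        "\<lambda>A. abs_rg_class (contract H A)"]
    by (simp add: convolution_def basis_def)
  also have "\<dots> = (\<Sum>A\<in>Pow (edges H). f (basis (subgraph H (verts H) A)) * g (basis (contract H A)))"
    by (intro sum.cong refl) (auto simp: delete_def double_diff)
  finally show ?thesis .
qed

text \<open>With \<open>a\<close> and \<open>b\<close> standing for square roots of the arguments, this is the value of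
  \<open>exp\<^sub>*(\<delta>)\<close> on \<open>G\<close>: the exponents are \<open>2\<rho>(G)\<close> and \<open>2(|E| - \<rho>(G))\<close>.\<close>

definition weight :: "'k::field_char_0 \<Rightarrow> 'k \<Rightarrow> rg \<Rightarrow> 'k" where
  "weight a b G = a ^ nat (int (card (edges G)) - defect G (edges G)) *
    b ^ nat (int (card (edges G)) + defect G (edges G))"

lemma weight_equiv: "rg_equiv G H \<Longrightarrow> weight a b G = weight a b H"
  using same_defect_equiv[of G H] same_defect_card_edges[of G H] same_defect_defect_edges[of G H]
  by (simp add: weight_def)

lemma weight_subgraph:
  assumes "ribbon_graph G" "A \<subseteq> edges G"
  shows "weight a b (subgraph G W A) = a ^ nat (int (card A) - defect G A) * b ^ nat (int (card A) + defect G A)"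
  using edges_subgraph[OF assms] defect_subgraph[OF assms order_refl] by (simp add: weight_def)

lemma card_Diff_edges:
  assumes "ribbon_graph G" "A \<subseteq> edges G"
  shows "int (card (edges G - A)) = int (card (edges G)) - int (card A)"
proof -
  have "finite A" "card A \<le> card (edges G)"
    using finite_edges[OF assms(1)] assms(2) finite_subset card_mono by blast+
  then show ?thesis using card_Diff_subset[OF _ assms(2)] by simp
qed

lemma weight_contract:
  assumes G: "ribbon_graph G" and A: "A \<subseteq> edges G"
  shows "weight a b (contract G A) =
    a ^ nat ((int (card (edges G)) - defect G (edges G)) - (int (card A) - defect G A)) *
    b ^ nat ((int (card (edges G)) + defect G (edges G)) - (int (card A) + defect G A))"
proof -
  have "A \<union> (edges G - A) = edges G" using A by blast
  then have d: "defect (contract G A) (edges G - A) = defect G (edges G) - defect G A"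
    using defect_contract[OF G A order_refl] by simp
  show ?thesis
    unfolding weight_def edges_contract[OF G A] card_Diff_edges[OF G A] d
    by (simp add: algebra_simps)
qed

text \<open>Follows from \<open>abs_defect_le\<close> for \<open>A\<close> and for the contraction
  by \<open>A\<close>. It ensures that \<open>nat\<close> and subtraction of exponents never
  truncate.\<close>

lemma exponents_mono:
  assumes G: "ribbon_graph G" and A: "A \<subseteq> edges G"
  shows "0 \<le> int (card A) - defect G A" "0 \<le> int (card A) + defect G A"
    "int (card A) - defect G A \<le> int (card (edges G)) - defect G (edges G)"
    "int (card A) + defect G A \<le> int (card (edges G)) + defect G (edges G)"
proof -
  show "0 \<le> int (card A) - defect G A" "0 \<le> int (card A) + defect G A"
    using abs_defect_le[OF G A] by auto
  have "A \<union> (edges G - A) = edges G" using A by blast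
  then have "\<bar>defect G (edges G) - defect G A\<bar> \<le> int (card (edges G)) - int (card A)"
    using abs_defect_le[OF ribbon_graph_contract[OF G A] order_refl]
      defect_contract[OF G A order_refl] edges_contract[OF G A] card_Diff_edges[OF G A] by simp
  then show "int (card A) - defect G A \<le> int (card (edges G)) - defect G (edges G)"
    "int (card A) + defect G A \<le> int (card (edges G)) + defect G (edges G)" by auto
qed

text \<open>Both exponents of \<open>a\<close> and \<open>b\<close> add up along restriction and
  contraction by \<open>defect_subgraph\<close> and \<open>defect_contract\<close>.\<close>

lemma weight_mult:
  assumes G: "ribbon_graph G" and A: "A \<subseteq> edges G"
  shows "weight a b (subgraph G W A) * weight a b (contract G A) = weight a b G"
proof -
  note e = exponents_mono[OF assms]
  have "a ^ nat m * a ^ nat (n - m) = a ^ nat n" if "0 \<le> m" "m \<le> n" for a :: 'a and m n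
    using that by (simp add: power_add[symmetric] nat_add_distrib[symmetric])
  from this[OF e(1,3)] this[OF e(2,4)] show ?thesis
    unfolding weight_subgraph[OF assms] weight_contract[OF assms]
    by (simp add: weight_def mult_ac)
qed

lemma delta_basis:
  assumes "ribbon_graph X" "ribbon_graph G"
  shows "delta X (basis G) = (if rg_equiv G X then 1 else 0)"
  using rg_class_eq_iff[OF assms(2,1)] by (simp add: delta_def basis_def lookup_single when_def)

text \<open>For defects \<open>-1\<close>, \<open>1\<close> and \<open>0\<close> the exponents of
  the two roots are \<open>2, 0\<close>, then \<open>0, 2\<close>, then \<open>1, 1\<close>, giving
  the three coefficients.\<close>

lemma delta_comb_basis:
  assumes G: "ribbon_graph G"
    and x: "(rt x1)\<^sup>2 = x1" "(rt x2)\<^sup>2 = x2" "rt (x1 * x2) = rt x1 * rt x2"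
  shows "delta_comb rt x1 x2 (basis G) =
    (if card (edges G) = 1 then weight (rt x1) (rt x2) G else 0)"
proof (cases "card (edges G) = 1")
  case True
  consider "defect G (edges G) = -1" | "defect G (edges G) = 1" | "defect G (edges G) = 0"
    using one_edge_classification[OF G True] rg_equiv_one_edge_iff[OF G] by blast
  then show ?thesis
    using True x
    by cases (simp_all add: delta_comb_def delta_basis ribbon_graph_one_edge G
        rg_equiv_one_edge_iff weight_def)
next
  case False
  then show ?thesis
    by (simp add: delta_comb_def delta_basis ribbon_graph_one_edge G rg_equiv_one_edge_iff)
qed

lemma counit_basis:
  assumes G: "ribbon_graph G"
  shows "counit (basis G) = (if edges G = {} then 1 else 0)"
proof -
  have "(\<exists>H. ribbon_graph H \<and> abs_rg_class G = abs_rg_class H \<and> edges H = {}) \<longleftrightarrow> edges G = {}"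
    using rg_class_eq_iff[OF G] same_defect_equiv same_defect_card_edges finite_edges G
    by (metis card_0_eq card.empty)
  then show ?thesis by (simp add: counit_def basis_def)
qed

text \<open>\<open>k\<close>-fold convolution peels off the edges one by one, in any of the \<open>k!\<close> orders.\<close>

lemma conv_power_basis:
  fixes rt :: "'k::field_char_0 \<Rightarrow> 'k"
  assumes x: "(rt x1)\<^sup>2 = x1" "(rt x2)\<^sup>2 = x2" "rt (x1 * x2) = rt x1 * rt x2"
    and "ribbon_graph G"
  shows "conv_power (delta_comb rt x1 x2) k (basis G) =
    (if card (edges G) = k then fact k * weight (rt x1) (rt x2) G else 0)"
  using assms(4)
proof (induction k arbitrary: G)
  case 0
  then show ?case
    using finite_edges[OF 0] by (auto simp: counit_basis weight_def defect_empty)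
next
  case (Suc k G)
  let ?w = "weight (rt x1) (rt x2)" and ?\<delta> = "delta_comb rt x1 x2"
  define H where "H = rep_rg_class (abs_rg_class G)"
  have H: "ribbon_graph H" by (simp add: H_def ribbon_graph_rep)
  have GH: "rg_equiv G H" using rep_abs_rg_class[OF Suc.prems] by (simp add: H_def)
  have fin: "finite (edges H)" by (rule finite_edges[OF H])
  have "conv_power ?\<delta> (Suc k) (basis G) = (\<Sum>A\<in>Pow (edges H).
      ?\<delta> (basis (subgraph H (verts H) A)) * conv_power ?\<delta> k (basis (contract H A)))"
    by (simp add: convolution_basis[OF H_def])
  also have "\<dots> = (\<Sum>A\<in>Pow (edges H). if card A = 1 \<and> card (edges H) = Suc k then fact k * ?w H else 0)"
  proof (intro sum.cong refl)
    fix A assume "A \<in> Pow (edges H)"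
    then have A: "A \<subseteq> edges H" by simp
    have \<delta>: "?\<delta> (basis (subgraph H (verts H) A)) =
        (if card A = 1 then ?w (subgraph H (verts H) A) else 0)"
      using delta_comb_basis[OF ribbon_graph_subgraph[OF H A] x] edges_subgraph[OF H A] by simp
    have P: "conv_power ?\<delta> k (basis (contract H A)) =
        (if card (edges H - A) = k then fact k * ?w (contract H A) else 0)"
      using Suc.IH[OF ribbon_graph_contract[OF H A]] edges_contract[OF H A] by simp
    have "card (edges H - A) = k \<longleftrightarrow> card (edges H) = Suc k" if "card A = 1"
      using card_Diff_edges[OF H A] that by linarith
    then show "?\<delta> (basis (subgraph H (verts H) A)) * conv_power ?\<delta> k (basis (contract H A)) =
        (if card A = 1 \<and> card (edges H) = Suc k then fact k * ?w H else 0)"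
      unfolding \<delta> P using weight_mult[OF H A, of "rt x1" "rt x2" "verts H"]
      by (auto simp: mult_ac)
  qed
  also have "\<dots> = (\<Sum>A\<in>{A. A \<subseteq> edges H \<and> card A = 1}. if card (edges H) = Suc k then fact k * ?w H else 0)"
    using fin by (intro sum.mono_neutral_cong_right) auto
  \<comment> \<open>One equal summand for each choice of the first edge: \<open>Suc k\<close> of
    them turn \<open>fact k\<close> into \<open>fact (Suc k)\<close>.\<close>
  also have "\<dots> = of_nat (card (edges H)) * (if card (edges H) = Suc k then fact k * ?w H else 0)"
    using n_subsets[OF fin, of 1] by simp
  also have "\<dots> = (if card (edges H) = Suc k then fact (Suc k) * ?w H else 0)" by simp
  finally show ?case
    using weight_equiv[OF GH, of "rt x1" "rt x2"] same_defect_card_edges[OF same_defect_equiv[OF GH]] by simp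
qed

text \<open>Only the term whose index is the number of edges survives, and its factorial
  cancels.\<close>

lemma conv_exp_basis:
  fixes rt :: "'k::field_char_0 \<Rightarrow> 'k"
  assumes "(rt x1)\<^sup>2 = x1" "(rt x2)\<^sup>2 = x2" "rt (x1 * x2) = rt x1 * rt x2" "ribbon_graph G"
  shows "conv_exp (delta_comb rt x1 x2) (basis G) = weight (rt x1) (rt x2) G"
  unfolding conv_exp_def conv_power_basis[OF assms]
  by (subst Sum_any.expand_superset[of "{card (edges G)}"]) (auto split: if_splits)

section \<open>The ribbon graph polynomial as a character\<close>

lemma sum_same_defect:
  assumes "same_defect G H"
  shows "(\<Sum>A\<in>Pow (edges G). \<Phi> (card A) (defect G A)) = (\<Sum>A\<in>Pow (edges H). \<Phi> (card A) (defect H A))"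
proof -
  obtain \<beta> where \<beta>: "bij_betw \<beta> (edges G) (edges H)"
      "\<And>A. A \<subseteq> edges G \<Longrightarrow> defect H (\<beta> ` A) = defect G A"
    using assms by (auto simp: same_defect_def)
  have "card (\<beta> ` A) = card A" if "A \<subseteq> edges G" for A
    using that \<beta>(1) by (metis bij_betw_def card_image inj_on_subset)
  then have "(\<Sum>A\<in>Pow (edges G). \<Phi> (card A) (defect G A)) =
      (\<Sum>A\<in>Pow (edges G). \<Phi> (card (\<beta> ` A)) (defect H (\<beta> ` A)))"
    using \<beta>(2) by (intro sum.cong) auto
  also have "\<dots> = (\<Sum>A\<in>Pow (edges H). \<Phi> (card A) (defect H A))"
    by (rule sum.reindex_bij_betw[OF bij_betw_Pow[OF \<beta>(1)]])
  finally show ?thesis .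
qed

text \<open>Twice each exponent is an integer by \<open>rho_eq_defect\<close> and nonnegative by
  \<open>exponents_mono\<close>, so \<open>half_pow\<close> is an ordinary power of the
  root.\<close>

lemma half_pow_rho:
  assumes G: "ribbon_graph G" and A: "A \<subseteq> edges G"
  shows "half_pow rt z (rho G A) = rt z ^ nat (int (card A) - defect G A)"
    and "half_pow rt z (of_nat (card A) - rho G A) = rt z ^ nat (int (card A) + defect G A)"
    and "half_pow rt z (rho G (edges G) - rho G A) =
      rt z ^ nat ((int (card (edges G)) - defect G (edges G)) - (int (card A) - defect G A))"
proof -
  note e = exponents_mono[OF assms] and r = rho_eq_defect[OF assms] rho_eq_defect[OF G order_refl]
  have hp: "half_pow rt z q = rt z ^ nat n" if "2 * q = of_int n" "0 \<le> n" for q n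
    using that by (simp add: half_pow_def power_int_def)
  show "half_pow rt z (rho G A) = rt z ^ nat (int (card A) - defect G A)"
    by (rule hp) (use e in \<open>simp_all add: r\<close>)
  show "half_pow rt z (of_nat (card A) - rho G A) = rt z ^ nat (int (card A) + defect G A)"
    by (rule hp) (use e in \<open>simp_all add: r field_simps\<close>)
  show "half_pow rt z (rho G (edges G) - rho G A) =
      rt z ^ nat ((int (card (edges G)) - defect G (edges G)) - (int (card A) - defect G A))"
    by (rule hp) (use e in \<open>simp_all add: r field_simps\<close>)
qed

theorem theorem3p32:
  fixes rt :: "'k::field_char_0 \<Rightarrow> 'k" and x1 x2 y1 y2 :: 'k and G :: rg
  assumes "ribbon_graph G"
    and "x1 \<noteq> 0" and "y2 \<noteq> 0"
    and "(rt x1)\<^sup>2 = x1" and "(rt x2)\<^sup>2 = x2" and "(rt y1)\<^sup>2 = y1" and "(rt y2)\<^sup>2 = y2"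
    and "rt (x1 * x2) = rt x1 * rt x2" and "rt (y1 * y2) = rt y1 * rt y2"
    and "rt (y1 / x1) = rt y1 / rt x1" and "rt (x2 / y2) = rt x2 / rt y2"
  shows "alpha rt (x1, x2) (y1, y2) (basis G) =
    half_pow rt x1 (rho G (edges G)) *
    half_pow rt y2 (of_nat (card (edges G)) - rho G (edges G)) *
    R_tilde rt G (y1 / x1 + 1) (x2 / y2 + 1)"
proof -
  note G = \<open>ribbon_graph G\<close>
  define H where "H = rep_rg_class (abs_rg_class G)"
  have H: "ribbon_graph H" by (simp add: H_def ribbon_graph_rep)
  have GH: "same_defect G H"
    using same_defect_equiv[OF rep_abs_rg_class[OF G]] by (simp add: H_def)
  \<comment> \<open>\<open>m\<close> and \<open>n\<close> are twice the rank \<open>rho\<close> and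
    twice the corank, that is, the exponents of the square roots.\<close>
  define m where "m = (\<lambda>F A. nat (int (card A) - defect F A))"
  define n where "n = (\<lambda>F A. nat (int (card A) + defect F A))"
  define M N where "M = m G (edges G)" and "N = n G (edges G)"
  have MN: "M = m H (edges H)" "N = n H (edges H)"
    using same_defect_card_edges[OF GH] same_defect_defect_edges[OF GH]
    by (simp_all add: M_def N_def m_def n_def)
  have nz: "rt x1 \<noteq> 0" "rt y2 \<noteq> 0" using assms by auto
  have mono: "m G A \<le> M" "n G A \<le> N" if "A \<subseteq> edges G" for A
    using exponents_mono[OF G that] by (simp_all add: m_def n_def M_def N_def)
  have "alpha rt (x1, x2) (y1, y2) (basis G) = (\<Sum>A\<in>Pow (edges H).
      weight (rt x1) (rt x2) (subgraph H (verts H) A) * weight (rt y1) (rt y2) (contract H A))"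
    unfolding alpha_def fst_conv snd_conv convolution_basis[OF H_def]
    using assms ribbon_graph_subgraph[OF H] ribbon_graph_contract[OF H]
    by (intro sum.cong refl) (simp add: conv_exp_basis)
  also have "\<dots> = (\<Sum>A\<in>Pow (edges H).
      rt x1 ^ m H A * rt x2 ^ n H A * (rt y1 ^ (M - m H A) * rt y2 ^ (N - n H A)))"
    using exponents_mono[OF H]
    by (intro sum.cong refl)
      (simp add: weight_subgraph[OF H] weight_contract[OF H] m_def n_def MN nat_diff_distrib)
  \<comment> \<open>The terms depend only on size and defect, so the sum moves from the
    representative \<open>H\<close> back to \<open>G\<close>.\<close>
  also have "\<dots> = (\<Sum>A\<in>Pow (edges G).
      rt x1 ^ m G A * rt x2 ^ n G A * (rt y1 ^ (M - m G A) * rt y2 ^ (N - n G A)))"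
    using sum_same_defect[OF GH, symmetric,
      of "\<lambda>c d. rt x1 ^ nat (int c - d) * rt x2 ^ nat (int c + d) *
        (rt y1 ^ (M - nat (int c - d)) * rt y2 ^ (N - nat (int c + d)))"]
    by (simp add: m_def n_def)
  \<comment> \<open>Completing the powers of \<open>rt x1\<close> and \<open>rt y2\<close> to the
    exponents \<open>M\<close> and \<open>N\<close> puts \<open>rt x1\<close> and
    \<open>rt y2\<close> into the denominators.\<close>
  also have "\<dots> = (\<Sum>A\<in>Pow (edges G). rt x1 ^ M * rt y2 ^ N *
      ((rt y1 / rt x1) ^ (M - m G A) * (rt x2 / rt y2) ^ n G A))"
  proof (intro sum.cong refl)
    fix A assume "A \<in> Pow (edges G)"
    then have "rt x1 ^ M = rt x1 ^ m G A * rt x1 ^ (M - m G A)"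
      "rt y2 ^ N = rt y2 ^ n G A * rt y2 ^ (N - n G A)"
      using mono by (simp_all add: power_add[symmetric])
    then show "rt x1 ^ m G A * rt x2 ^ n G A * (rt y1 ^ (M - m G A) * rt y2 ^ (N - n G A)) =
        rt x1 ^ M * rt y2 ^ N * ((rt y1 / rt x1) ^ (M - m G A) * (rt x2 / rt y2) ^ n G A)"
      using nz by (simp add: power_divide)
  qed
  \<comment> \<open>The shift by one in the arguments of \<open>R_tilde\<close> leaves the roots of
    the two quotients, which are the quotients of the roots.\<close>
  also have "\<dots> = rt x1 ^ M * rt y2 ^ N * R_tilde rt G (y1 / x1 + 1) (x2 / y2 + 1)"
    unfolding R_tilde_def sum_distrib_left
    using assms(10,11) exponents_mono[OF G]
    by (intro sum.cong refl)
      (simp add: half_pow_rho[OF G] m_def n_def M_def nat_diff_distrib)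
  finally show ?thesis
    by (simp add: half_pow_rho[OF G order_refl] M_def N_def m_def n_def)
qed

end
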